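(* Consider $\alpha$-divergence loss $L_\alpha$ with $n=\frac{2}{1-\alpha}\in\{1,2,\ldots\}$. The Bayes predictive density $\hat q_{\pi_{U,A}}(y_1;x)$, $y_1\in\mathbb{R}^p$, of the density of $Y_1$ with respect to the (uniform) prior $\pi_{U,A}(\theta)=\mathbb{I}_A(\theta_1-\theta_2)$ is given by $$\hat q_{\pi_{U,A}}(y_1;x)=\hat q_{\mathrm{mre}}(y_1;x_1)\,\frac{\{\mathbb{P}(T\in A)\}^n}{\mathbb{P}\left(\cap_{i=1}^n\{Z_i\in A\}\right)},$$ with $\hat q_{\mathrm{mre}}(y_1;x_1)$ a $N_p\big(x_1,(\sigma_1^2/n+\sigma_Y^2)I_p\big)$ density; $T\sim N_p(\mu_T,\sigma_T^2I_p)$ with $\mu_T=\beta(y_1-x_1)+(x_1-x_2)$, $\sigma_T^2=\sigma_2^2+n\sigma_Y^2\beta$, $\beta=\frac{\sigma_1^2}{\sigma_1^2+n\sigma_Y^2}$; and $Z=(Z_1,\ldots,Z_n)'\sim N_{np}(\mu_Z,\Sigma_Z)$ with $\mu_Z=1_n\otimes(x_1-x_2)$ and $$\Sigma_Z=(\sigma_T^2+\sigma_Y^2\beta^2)\,I_{np}+\left(\frac{\beta^2\sigma_1^2}{n}\,1_n1_n'\otimes I_p\right).$$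
   Context: Model: $X=(X_1,X_2)$ and $Y_1$, with $X_1\sim N_p(\theta_1,\sigma_1^2I_p)$, $X_2\sim N_p(\theta_2,\sigma_2^2I_p)$, $Y_1\sim N_p(\theta_1,\sigma_Y^2I_p)$ independently distributed, where $\sigma_1^2,\sigma_2^2,\sigma_Y^2$ are known, $\theta=(\theta_1,\theta_2)\in\mathbb{R}^{2p}$, and $\theta_1-\theta_2\in A$ for a known $A\subset\mathbb{R}^p$. Let $q_{\theta_1}$ be the density of $Y_1$; $x=(x_1,x_2)$ is the observed value of $X$, and $\mathbb{I}_A$ is the indicator function of $A$. $\alpha$-divergence loss: $L_\alpha(\theta,\hat q)=\int_{\mathbb{R}^p}h_\alpha\!\left(\frac{\hat q(y;x)}{q_{\theta_1}(y)}\right)q_{\theta_1}(y)\,dy$, where $h_\alpha(z)=\frac{4}{1-\alpha^2}(1-z^{(1+\alpha)/2})$ for $|\alpha|<1$ and $h_{-1}(z)=-\log z$. The Bayes predictive density for a prior is the density $\hat q(\cdot;x)$ minimizing the posterior expected loss given $X=x$. $\hat q_{\mathrm{mre}}$ is the minimum risk equivariant predictive density based on $x_1$. Each $Z_i$ takes values in $\mathbb{R}^p$, $I_m$ is the $m\times m$ identity matrix, $1_n$ is the $n$-dimensional column vector of ones, and $\otimes$ is the Kronecker product.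
   Formalization: Proved with Σ_Z = σ_T² I_np + β²(σ_1²/n + σ_Y²)(1_n1_n' ⊗ I_p); the printed Σ_Z has wrong off-diagonal blocks for n ≥ 2, so the printed density need not integrate to 1. A is taken Borel with positive Lebesgue measure, so that the posterior exists. *)

theory Defs
  imports "HOL-Probability.Probability"
begin

section \<open>Multivariate normal distributions and Kronecker products\<close>

definition mvn_density :: "real^'m \<Rightarrow> real^'m^'m \<Rightarrow> real^'m \<Rightarrow> real" where
  "mvn_density \<mu> S z =
     exp (- ((z - \<mu>) \<bullet> (matrix_inv S *v (z - \<mu>))) / 2) / sqrt ((2 * pi) ^ CARD('m) * det S)"

definition mvn :: "real^'m \<Rightarrow> real^'m^'m \<Rightarrow> (real^'m) measure" where
  "mvn \<mu> S = density lborel (\<lambda>z. ennreal (mvn_density \<mu> S z))"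

text \<open>A vector of dimension \<open>n p\<close> is indexed by pairs \<open>(i, k)\<close>; the pair stands for
  coordinate \<open>k\<close> of the \<open>i\<close>-th block \<open>Z\<^sub>i\<close>.\<close>

definition block :: "'n \<Rightarrow> real^('n::finite \<times> 'p::finite) \<Rightarrow> real^'p" where
  "block i z = (\<chi> k. z $ (i, k))"

definition kron_vec :: "real^'n \<Rightarrow> real^'p \<Rightarrow> real^('n::finite \<times> 'p::finite)" where
  "kron_vec u v = (\<chi> r. u $ fst r * v $ snd r)"

definition kron :: "real^'n^'n \<Rightarrow> real^'p^'p \<Rightarrow> real^('n \<times> 'p)^('n::finite \<times> 'p::finite)" where
  "kron B C = (\<chi> r c. B $ fst r $ fst c * C $ snd r $ snd c)"

text \<open>The matrix \<open>u v'\<close>.\<close>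

definition outer :: "real^'n \<Rightarrow> real^'n \<Rightarrow> real^'n^'n" where
  "outer u v = (\<chi> i j. u $ i * v $ j)"


section \<open>Alpha-divergence loss\<close>

text \<open>The loss may be infinite when \<open>\<alpha> = -1\<close>. It is therefore computed with an integral valued in
  the extended reals; the Bochner integral would assign the value 0 to a non-integrable integrand.
  The difference is never \<open>\<infinity> - \<infinity>\<close> for the losses below.\<close>

definition ereal_integral :: "'b measure \<Rightarrow> ('b \<Rightarrow> ereal) \<Rightarrow> ereal" where
  "ereal_integral M f =
     enn2ereal (\<integral>\<^sup>+ x. e2ennreal (f x) \<partial>M) - enn2ereal (\<integral>\<^sup>+ x. e2ennreal (- f x) \<partial>M)"

text \<open>The case \<open>z = 0\<close> makes \<open>- log 0 = \<infinity>\<close>; in the library \<open>ln 0 = 0\<close>.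
  Only \<open>-1 \<le> \<alpha> < 1\<close> and \<open>z \<ge> 0\<close> are meaningful.\<close>

definition h_alpha :: "real \<Rightarrow> real \<Rightarrow> ereal" where
  "h_alpha \<alpha> z =
     (if \<alpha> = - 1 then (if z = 0 then \<infinity> else ereal (- ln z))
      else ereal (4 / (1 - \<alpha>\<^sup>2) * (1 - z powr ((1 + \<alpha>) / 2))))"

definition alpha_loss :: "real \<Rightarrow> real \<Rightarrow> real^'p \<Rightarrow> (real^'p \<Rightarrow> real) \<Rightarrow> ereal" where
  "alpha_loss \<alpha> \<sigma>Y \<theta>1 q =
     (let q\<theta> = mvn_density \<theta>1 (\<sigma>Y\<^sup>2 *\<^sub>R mat 1)
      in ereal_integral lborel (\<lambda>y. h_alpha \<alpha> (q y / q\<theta> y) * ereal (q\<theta> y)))"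


section \<open>Predictive densities\<close>

definition is_density :: "(real^'p \<Rightarrow> real) \<Rightarrow> bool" where
  "is_density q \<longleftrightarrow>
     q \<in> borel_measurable borel \<and> (\<forall>y. 0 \<le> q y) \<and> (\<integral>\<^sup>+ y. ennreal (q y) \<partial>lborel) = 1"

text \<open>Density at \<open>(x1, x2)\<close> of the independent pair \<open>X = (X1, X2)\<close>, as a function of \<open>\<theta>\<close>.\<close>

definition likelihood ::
  "real \<Rightarrow> real \<Rightarrow> (real^'p) \<times> (real^'p) \<Rightarrow> (real^'p) \<times> (real^'p) \<Rightarrow> real" where
  "likelihood \<sigma>1 \<sigma>2 x \<theta> =
     mvn_density (fst \<theta>) (\<sigma>1\<^sup>2 *\<^sub>R mat 1) (fst x) * mvn_density (snd \<theta>) (\<sigma>2\<^sup>2 *\<^sub>R mat 1) (snd x)"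

text \<open>The prior \<open>\<pi>\<close> is a density with respect to Lebesgue measure and may be improper.\<close>

definition posterior ::
  "real \<Rightarrow> real \<Rightarrow> ((real^'p) \<times> (real^'p) \<Rightarrow> real) \<Rightarrow> (real^'p) \<times> (real^'p) \<Rightarrow> ((real^'p) \<times> (real^'p)) measure"
  where
  "posterior \<sigma>1 \<sigma>2 \<pi> x = density lborel
     (\<lambda>\<theta>. ennreal (likelihood \<sigma>1 \<sigma>2 x \<theta> * \<pi> \<theta>)
        / (\<integral>\<^sup>+ \<theta>'. ennreal (likelihood \<sigma>1 \<sigma>2 x \<theta>' * \<pi> \<theta>') \<partial>lborel))"

definition posterior_expected_loss ::
  "real \<Rightarrow> real \<Rightarrow> real \<Rightarrow> real \<Rightarrow> ((real^'p) \<times> (real^'p) \<Rightarrow> real) \<Rightarrow> (real^'p) \<times> (real^'p)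
     \<Rightarrow> (real^'p \<Rightarrow> real) \<Rightarrow> ereal" where
  "posterior_expected_loss \<alpha> \<sigma>1 \<sigma>2 \<sigma>Y \<pi> x q =
     ereal_integral (posterior \<sigma>1 \<sigma>2 \<pi> x) (\<lambda>\<theta>. alpha_loss \<alpha> \<sigma>Y (fst \<theta>) q)"

definition is_bayes_predictive ::
  "real \<Rightarrow> real \<Rightarrow> real \<Rightarrow> real \<Rightarrow> ((real^'p) \<times> (real^'p) \<Rightarrow> real) \<Rightarrow> (real^'p) \<times> (real^'p)
     \<Rightarrow> (real^'p \<Rightarrow> real) \<Rightarrow> bool" where
  "is_bayes_predictive \<alpha> \<sigma>1 \<sigma>2 \<sigma>Y \<pi> x q \<longleftrightarrow>
     is_density q \<and>
     (\<forall>q'. is_density q' \<longrightarrow>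
        posterior_expected_loss \<alpha> \<sigma>1 \<sigma>2 \<sigma>Y \<pi> x q \<le> posterior_expected_loss \<alpha> \<sigma>1 \<sigma>2 \<sigma>Y \<pi> x q')"

definition prior_UA :: "(real^'p) set \<Rightarrow> (real^'p) \<times> (real^'p) \<Rightarrow> real" where
  "prior_UA A \<theta> = indicator A (fst \<theta> - snd \<theta>)"

text \<open>Predictive densities based on \<open>x1\<close> are written \<open>q y x1\<close>. The group is that of translations,
  acting on \<open>x1\<close>, \<open>y\<close> and \<open>\<theta>1\<close> simultaneously.\<close>

definition is_equivariant :: "(real^'p \<Rightarrow> real^'p \<Rightarrow> real) \<Rightarrow> bool" where
  "is_equivariant q \<longleftrightarrow>
     (\<forall>x1. is_density (\<lambda>y. q y x1)) \<and> (\<forall>c y x1. q (y + c) (x1 + c) = q y x1)"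

definition risk1 ::
  "real \<Rightarrow> real \<Rightarrow> real \<Rightarrow> (real^'p \<Rightarrow> real^'p \<Rightarrow> real) \<Rightarrow> real^'p \<Rightarrow> ereal" where
  "risk1 \<alpha> \<sigma>1 \<sigma>Y q \<theta>1 =
     ereal_integral (mvn \<theta>1 (\<sigma>1\<^sup>2 *\<^sub>R mat 1)) (\<lambda>x1. alpha_loss \<alpha> \<sigma>Y \<theta>1 (\<lambda>y. q y x1))"

definition is_mre ::
  "real \<Rightarrow> real \<Rightarrow> real \<Rightarrow> (real^'p \<Rightarrow> real^'p \<Rightarrow> real) \<Rightarrow> bool" where
  "is_mre \<alpha> \<sigma>1 \<sigma>Y q \<longleftrightarrow>
     is_equivariant q \<and>
     (\<forall>q' \<theta>1. is_equivariant q' \<longrightarrow> risk1 \<alpha> \<sigma>1 \<sigma>Y q \<theta>1 \<le> risk1 \<alpha> \<sigma>1 \<sigma>Y q' \<theta>1)"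

text \<open>Covariance of \<open>Z\<close>: the theorem uses
  \<open>\<sigma>\<^sub>T\<^sup>2 I + \<beta>\<^sup>2 (\<sigma>\<^sub>1\<^sup>2/n + \<sigma>\<^sub>Y\<^sup>2) (1 1' \<otimes> I)\<close>. The source prints
  \<open>(\<sigma>\<^sub>T\<^sup>2 + \<sigma>\<^sub>Y\<^sup>2 \<beta>\<^sup>2) I + (\<beta>\<^sup>2 \<sigma>\<^sub>1\<^sup>2/n) (1 1' \<otimes> I)\<close>, which agrees on the diagonal blocks, and hence for
  \<open>n = 1\<close>. For \<open>n \<ge> 2\<close> the off-diagonal blocks differ, and with the printed matrix the stated
  function does not in general integrate to 1. The normalising constant is
  \<open>E [P(T \<in> A)\<^sup>n]\<close>, with \<open>y\<^sub>1\<close> drawn from the \<open>N(x\<^sub>1, (\<sigma>\<^sub>1\<^sup>2/n + \<sigma>\<^sub>Y\<^sup>2) I)\<close> density,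
  so the \<open>Z\<^sub>i\<close> share the term \<open>\<beta> (y\<^sub>1 - x\<^sub>1)\<close>, whose covariance is
  \<open>\<beta>\<^sup>2 (\<sigma>\<^sub>1\<^sup>2/n + \<sigma>\<^sub>Y\<^sup>2) I\<close>.\<close>

end

theory Submission
  imports Defs
begin

text \<open>
  Write \<open>\<phi>\<^sub>\<theta>\<close> for the density of \<open>Y\<^sub>1\<close>. For \<open>\<alpha> = 1 - 2/n\<close> with \<open>n \<ge> 2\<close>, the average loss of a density \<open>q\<close> under a
  probability measure \<open>P\<close> on the parameters is \<open>c (1 - \<integral> q^(1 - 1/n) m)\<close>, where \<open>m\<close> is the mean of
  \<open>\<phi>\<^sub>\<theta>^(1/n)\<close> under \<open>P\<close>. By Hoelder's inequality the minimiser is proportional to \<open>m^n\<close>. For \<open>n = 1\<close>, the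
  Kullback-Leibler case, the minimiser is \<open>m\<close>, which is the same formula. Both cases follow from one exact
  identity, \<open>mean_divergence_compensation\<close>: the average loss of any density is that of the minimiser \<open>q\<close>
  plus a positive constant times its divergence from \<open>q\<close>. Together with finiteness of the minimum this gives
  optimality and almost everywhere uniqueness (\<open>power_mean_density_optimal\<close>).

  Both claims of the theorem are instances. By translation invariance, the risk of an equivariant density
  is an average loss for \<open>P = N(0, \<sigma>\<^sub>1\<^sup>2 I)\<close> (\<open>risk1_equivariant\<close>), and the Bayes problem has the posterior as \<open>P\<close>.
  It remains to compute the two power means. Since \<open>\<phi>\<^sub>\<theta>^(1/n)\<close> is a multiple of a normal density with variance
  \<open>n \<sigma>\<^sub>Y\<^sup>2\<close>, they are convolutions of normal densities; for the posterior, restricting \<open>\<theta>\<^sub>1 - \<theta>\<^sub>2\<close> to \<open>A\<close> contributes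
  the factor \<open>P(T \<in> A)\<close>, whose \<open>n\<close>-th power appears in the answer (\<open>posterior_UA_power_mean\<close>).

  The normalising constant is the mean of \<open>P(T \<in> A)^n\<close> when \<open>y\<^sub>1\<close> follows the minimum risk equivariant density. It is the
  probability that \<open>n\<close> vectors that are conditionally independent copies of \<open>T\<close> given \<open>y\<^sub>1\<close> all lie in \<open>A\<close>. Jointly these
  vectors are normal with the covariance of \<open>Z\<close> (\<open>mvn_density_exchangeable\<close>, \<open>mvn_exchangeable_blocks\<close>), which
  requires the inverse and the determinant of \<open>t I + b (1 1' \<otimes> I)\<close>.
\<close>


section \<open>Isotropic normal densities\<close>

definition iso_normal :: "real \<Rightarrow> real^'p \<Rightarrow> real^'p \<Rightarrow> real" where
  "iso_normal v m z = exp (- (norm (z - m))\<^sup>2 / (2 * v)) / sqrt ((2 * pi * v) ^ CARD('p::finite))"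

lemma matrix_inv_eqI:
  fixes A B :: "'a::semiring_1^'n^'n"
  assumes "A ** B = mat 1" "B ** A = mat 1"
  shows "matrix_inv A = B"
proof -
  have *: "A ** matrix_inv A = mat 1 \<and> matrix_inv A ** A = mat 1"
    unfolding matrix_inv_def by (rule someI[of _ B]) (simp add: assms)
  then have "matrix_inv A = (B ** A) ** matrix_inv A"
    by (simp add: assms)
  also have "\<dots> = B ** (A ** matrix_inv A)"
    by (simp only: matrix_mul_assoc)
  finally show ?thesis using * by simp
qed

lemma mvn_density_scaled_mat_1:
  assumes "v > 0"
  shows "mvn_density m (v *\<^sub>R mat 1) z = iso_normal v m (z::real^'p::finite)"
proof -
  have mult: "(r *\<^sub>R mat 1) ** (s *\<^sub>R mat 1) = ((r * s) *\<^sub>R mat 1 :: real^'p^'p)" for r s :: real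
    by (simp add: scalar_matrix_assoc[symmetric] matrix_scalar_ac)
  have "matrix_inv (v *\<^sub>R mat 1 :: real^'p^'p) = inverse v *\<^sub>R mat 1"
    by (rule matrix_inv_eqI) (use assms in \<open>simp_all add: mult\<close>)
  moreover have "det (v *\<^sub>R mat 1 :: real^'p^'p) = v ^ CARD('p)"
    by (subst det_diagonal) (auto simp: mat_def)
  ultimately show ?thesis
    by (simp add: mvn_density_def iso_normal_def scaleR_matrix_vector_assoc[symmetric]
        power2_norm_eq_inner power_mult_distrib divide_simps)
qed

lemma iso_normal_pos: "v > 0 \<Longrightarrow> iso_normal v m z > 0"
  by (simp add: iso_normal_def)

lemma iso_normal_nonneg [simp]: "v > 0 \<Longrightarrow> 0 \<le> iso_normal v m z"
  by (simp add: iso_normal_def)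

lemma borel_measurable_iso_normal [measurable]:
  assumes "f \<in> borel_measurable M" "g \<in> borel_measurable M"
  shows "(\<lambda>x. iso_normal v (f x) (g x :: real^'p::finite)) \<in> borel_measurable M"
  unfolding iso_normal_def using assms by measurable

lemma iso_normal_translate: "iso_normal v m z = iso_normal v (m - c) (z - c)"
  by (simp add: iso_normal_def)

lemma iso_normal_commute: "iso_normal v m z = iso_normal v z m"
  by (simp add: iso_normal_def norm_minus_commute)

lemma iso_normal_prod:
  assumes "v > 0"
  shows "iso_normal v m (z::real^'p::finite) = (\<Prod>b\<in>Basis. normal_density (m \<bullet> b) (sqrt v) (z \<bullet> b))"
proof -
  have c: "card (Basis :: (real^'p) set) = CARD('p)" by simp
  have "(norm (z - m))\<^sup>2 = (\<Sum>b\<in>Basis. (z \<bullet> b - m \<bullet> b)\<^sup>2)"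
    by (subst power2_norm_eq_inner, subst euclidean_inner) (simp add: power2_eq_square inner_diff_left)
  then have "exp (- (norm (z - m))\<^sup>2 / (2 * v)) = (\<Prod>b\<in>Basis. exp (- (z \<bullet> b - m \<bullet> b)\<^sup>2 / (2 * v)))"
    by (simp add: exp_sum[symmetric] sum_negf sum_divide_distrib)
  moreover have "sqrt ((2 * pi * v) ^ CARD('p)) = (\<Prod>b\<in>(Basis::(real^'p) set). sqrt (2 * pi * v))"
    by (simp only: prod_constant c real_sqrt_power)
  ultimately have "iso_normal v m z
      = (\<Prod>b\<in>Basis. exp (- (z \<bullet> b - m \<bullet> b)\<^sup>2 / (2 * v)) / sqrt (2 * pi * v))"
    by (simp only: iso_normal_def prod_dividef)
  also have "\<dots> = (\<Prod>b\<in>Basis. normal_density (m \<bullet> b) (sqrt v) (z \<bullet> b))"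
    using assms by (intro prod.cong) (simp_all add: normal_density_def)
  finally show ?thesis .
qed

lemma nn_integral_iso_normal:
  assumes "v > 0"
  shows "(\<integral>\<^sup>+ z. ennreal (iso_normal v m z) \<partial>lborel) = (1::ennreal)"
proof -
  have one: "(\<integral>\<^sup>+ x. ennreal (normal_density a (sqrt v) x) \<partial>lborel) = 1" for a
    using assms by (subst nn_integral_eq_integral) auto
  have eq: "ennreal (iso_normal v m z) = (\<Prod>b\<in>Basis. ennreal (normal_density (m \<bullet> b) (sqrt v) (z \<bullet> b)))" for z
    by (simp only: iso_normal_prod[OF assms] prod_ennreal normal_density_nonneg)
  show ?thesis
    unfolding eq
    using nn_integral_lborel_prod[where f="\<lambda>b x. ennreal (normal_density (m \<bullet> b) (sqrt v) x)"]
    by (simp add: one)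
qed

lemma is_density_iso_normal:
  assumes "v > 0"
  shows "is_density (iso_normal v (m::real^'p::finite))"
proof -
  have "(\<lambda>z. iso_normal v m z) \<in> borel_measurable borel"
    by measurable
  then show ?thesis
    using assms by (simp add: is_density_def nn_integral_iso_normal)
qed

text \<open>For normalising constants: the factors \<open>sqrt ((2 * pi * v) ^ p)\<close> are compared through their bases.\<close>

lemma sqrt_power_mult_eq:
  fixes a b c d :: real
  assumes "a * b = c * d"
  shows "sqrt (a ^ k) * sqrt (b ^ k) = sqrt (c ^ k) * sqrt (d ^ k)"
  using assms by (metis power_mult_distrib real_sqrt_mult)

text \<open>Completing the square. As a function of \<open>u\<close> the product of two normal densities is a multiple of
  a third one; the multiple is the convolution density, and the third one is the conditional law.
  Both factors are needed: the conditional law of \<open>\<theta>\<^sub>1\<close> given \<open>x\<^sub>1\<close> and \<open>y\<close> determines \<open>T\<close>.\<close>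

lemma iso_normal_mult:
  assumes "v > 0" "w > 0"
  shows "iso_normal v a u * iso_normal w b u
    = iso_normal (v + w) a b * iso_normal (v * w / (v + w)) (a + (v / (v + w)) *\<^sub>R (b - a)) (u::real^'p::finite)"
proof -
  have sq: "(norm p)\<^sup>2 / (2 * v) + (norm (p - q))\<^sup>2 / (2*w)
      = (norm q)\<^sup>2 / (2*(v + w)) + (norm (p - (v / (v + w)) *\<^sub>R q))\<^sup>2 / (2 * (v * w / (v + w)))"
    for p q :: "real^'p"
  proof -
    have P: "P / (2 * v) + (P - 2*R + Q) / (2*w)
       = Q / (2*(v+w)) + (P - 2*(v/(v+w)*R) + v/(v+w)*(v/(v+w)*Q)) / (2 * (v * w / (v + w)))" for P Q R :: real
    proof -
      have "v + w \<noteq> 0" "v \<noteq> 0" "w \<noteq> 0" using assms by auto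
      then show ?thesis by (simp add: divide_simps) algebra
    qed
    show ?thesis
      using P[of "p \<bullet> p" "p \<bullet> q" "q \<bullet> q"]
      by (simp add: power2_norm_eq_inner inner_diff_left inner_diff_right inner_commute algebra_simps)
  qed
  have "exp (- (norm (u - a))\<^sup>2 / (2 * v)) * exp (- (norm (u - b))\<^sup>2 / (2*w))
     = exp (- (norm (b - a))\<^sup>2 / (2*(v+w)))
       * exp (- (norm (u - (a + (v / (v + w)) *\<^sub>R (b - a))))\<^sup>2 / (2 * (v * w / (v + w))))"
  proof -
    have e: "p + q = r + s \<Longrightarrow> exp (- p) * exp (- q) = exp (- r) * exp (- s)" for p q r s :: real
      by (simp add: exp_add[symmetric])
    show ?thesis
      using e[OF sq[of "u - a" "b - a"]] by (simp add: diff_diff_eq)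
  qed
  moreover have "sqrt ((2*pi * v) ^ CARD('p)) * sqrt ((2*pi*w) ^ CARD('p))
      = sqrt ((2*pi*(v+w)) ^ CARD('p)) * sqrt ((2*pi*(v * w / (v + w))) ^ CARD('p))"
    by (rule sqrt_power_mult_eq) (use assms in \<open>simp add: field_simps\<close>)
  ultimately show ?thesis by (simp add: iso_normal_def)
qed

lemma iso_normal_convolution:
  assumes "v > 0" "w > 0"
  shows "(\<integral>\<^sup>+ u. ennreal (iso_normal v a u) * ennreal (iso_normal w b u) \<partial>lborel)
    = ennreal (iso_normal (v + w) a b)"
  using assms
  by (simp add: ennreal_mult'[symmetric] iso_normal_mult[OF assms])
     (simp add: ennreal_mult' nn_integral_cmult nn_integral_iso_normal)

text \<open>Roots stay inside the normal family up to a constant, and the constant is independent of the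
  mean. This makes power means of normal densities computable by convolution.\<close>

lemma iso_normal_root:
  assumes "v > 0" "r > 0"
  obtains c where "c > 0" "\<And>m z::real^'p::finite. iso_normal v m z powr (1 / r) = c * iso_normal (r * v) m z"
proof
  let ?c = "sqrt ((2 * pi * (r * v)) ^ CARD('p)) / sqrt ((2 * pi * v) ^ CARD('p)) powr (1 / r)"
  show "?c > 0" using assms by simp
  show "iso_normal v m z powr (1 / r) = ?c * iso_normal (r * v) m z" for m z :: "real^'p"
    using assms by (simp add: iso_normal_def powr_divide exp_powr_real mult_ac)
qed

lemma nn_integral_translate:
  fixes f :: "'a::euclidean_space \<Rightarrow> ennreal"
  assumes [measurable]: "f \<in> borel_measurable borel"
  shows "(\<integral>\<^sup>+ x. f (x + c) \<partial>lborel) = (\<integral>\<^sup>+ x. f x \<partial>lborel)"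
proof -
  have "(\<integral>\<^sup>+ x. f x \<partial>lborel) = (\<integral>\<^sup>+ x. f x \<partial>distr lborel borel ((+) c))"
    by (simp add: lborel_distr_plus)
  also have "\<dots> = (\<integral>\<^sup>+ x. f (x + c) \<partial>lborel)"
    by (simp add: nn_integral_distr add.commute)
  finally show ?thesis by simp
qed

lemma nn_integral_reflect:
  fixes f :: "'a::euclidean_space \<Rightarrow> ennreal"
  assumes [measurable]: "f \<in> borel_measurable borel"
  shows "(\<integral>\<^sup>+ x. f (c - x) \<partial>lborel) = (\<integral>\<^sup>+ x. f x \<partial>lborel)"
proof -
  have "(lborel :: 'a measure) = distr lborel borel (\<lambda>x. c - x)"
    using lborel_affine[of "-1" c] by (simp add: density_1)
  then have "(\<integral>\<^sup>+ x. f x \<partial>lborel) = (\<integral>\<^sup>+ x. f x \<partial>distr lborel borel (\<lambda>x. c - x))"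
    by simp
  also have "\<dots> = (\<integral>\<^sup>+ x. f (c - x) \<partial>lborel)"
    by (simp add: nn_integral_distr)
  finally show ?thesis by simp
qed

text \<open>Substituting \<open>t = \<theta>1 - \<theta>2\<close> turns the left-hand side into a convolution: it is the probability that
  the difference of two independent normal vectors lies in \<open>A\<close>.\<close>

lemma iso_normal_difference:
  assumes "v > 0" "w > 0" and [measurable]: "A \<in> sets borel"
  shows "(\<integral>\<^sup>+ \<theta>1. (\<integral>\<^sup>+ \<theta>2. ennreal (iso_normal v a \<theta>1) * ennreal (iso_normal w b \<theta>2) * indicator A (\<theta>1 - \<theta>2) \<partial>lborel) \<partial>lborel)
    = (\<integral>\<^sup>+ t. ennreal (iso_normal (v + w) (a - b) t) * indicator A (t::real^'p::finite) \<partial>lborel)"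
proof -
  have "(\<integral>\<^sup>+ \<theta>2. ennreal (iso_normal v a \<theta>1) * ennreal (iso_normal w b \<theta>2) * indicator A (\<theta>1 - \<theta>2) \<partial>lborel)
     = (\<integral>\<^sup>+ t. ennreal (iso_normal v a \<theta>1) * ennreal (iso_normal w b (\<theta>1 - t)) * indicator A t \<partial>lborel)" for \<theta>1
    using nn_integral_reflect[of "\<lambda>t. ennreal (iso_normal v a \<theta>1) * ennreal (iso_normal w b (\<theta>1 - t)) * indicator A t" \<theta>1]
    by simp
  then have "(\<integral>\<^sup>+ \<theta>1. (\<integral>\<^sup>+ \<theta>2. ennreal (iso_normal v a \<theta>1) * ennreal (iso_normal w b \<theta>2) * indicator A (\<theta>1 - \<theta>2) \<partial>lborel) \<partial>lborel)
     = (\<integral>\<^sup>+ \<theta>1. (\<integral>\<^sup>+ t. ennreal (iso_normal v a \<theta>1) * ennreal (iso_normal w b (\<theta>1 - t)) * indicator A t \<partial>lborel) \<partial>lborel)"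
    by simp
  also have "\<dots> = (\<integral>\<^sup>+ t. (\<integral>\<^sup>+ \<theta>1. ennreal (iso_normal v a \<theta>1) * ennreal (iso_normal w b (\<theta>1 - t)) * indicator A t \<partial>lborel) \<partial>lborel)"
    by (rule lborel_pair.Fubini') measurable
  also have "\<dots> = (\<integral>\<^sup>+ t. (\<integral>\<^sup>+ \<theta>1. ennreal (iso_normal v a \<theta>1) * ennreal (iso_normal w (b + t) \<theta>1) \<partial>lborel) * indicator A t \<partial>lborel)"
  proof -
    have "iso_normal w b (\<theta>1 - t) = iso_normal w (b + t) \<theta>1" for \<theta>1 t
      using iso_normal_translate[of w "b + t" \<theta>1 t] by simp
    then show ?thesis by (simp add: nn_integral_multc)
  qed
  also have "\<dots> = (\<integral>\<^sup>+ t. ennreal (iso_normal (v + w) (a - b) t) * indicator A t \<partial>lborel)"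
  proof -
    have "iso_normal (v + w) a (b + t) = iso_normal (v + w) (a - b) t" for t
      using iso_normal_translate[of "v + w" a "b + t" b] by simp
    then show ?thesis by (simp add: iso_normal_convolution assms)
  qed
  finally show ?thesis .
qed


section \<open>The integrand of the alpha-divergence\<close>

text \<open>With \<open>\<alpha> = 1 - 2/n\<close> this is \<open>h_alpha \<alpha> (b / a) * a + n * (b - a)\<close>, in real arithmetic. The linear term
  integrates to \<open>0\<close> when \<open>a\<close> and \<open>b\<close> run through two densities, so it leaves the loss unchanged, and it makes
  the integrand nonnegative. Losses then become nonnegative integrals, to which Tonelli applies
  without integrability conditions.\<close>

definition kernel_gap :: "nat \<Rightarrow> real \<Rightarrow> real \<Rightarrow> real" where
  "kernel_gap n a b =
     (if n = 1 then a * ln (a / b)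
      else (real n)\<^sup>2 / (real n - 1) * (a - b powr (1 - 1 / n) * a powr (1 / n))) + n * (b - a)"

text \<open>The infinite value is \<open>- log 0\<close>, where \<open>kernel_gap\<close> would use the junk value \<open>ln (a / 0) = 0\<close>.\<close>

definition div_kernel :: "nat \<Rightarrow> real \<Rightarrow> real \<Rightarrow> ennreal" where
  "div_kernel n a b = (if n = 1 \<and> b = 0 then \<infinity> else ennreal (kernel_gap n a b))"

text \<open>With \<open>M\<close> the right-hand side, \<open>t * ln z - ln M\<close> is the weighted mean of \<open>ln (z / M)\<close> and \<open>ln (1 / M)\<close>;
  the bound \<open>ln x \<le> x - 1\<close> shows that it is at most \<open>0\<close>, and strictness comes from \<open>M \<noteq> 1\<close>.\<close>

lemma weighted_am_gm_strict:
  fixes z t :: real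
  assumes "0 < z" "0 < t" "t < 1" "z \<noteq> 1"
  shows "z powr t < t * z + (1 - t)"
proof -
  define M where "M = t * z + (1 - t)"
  have M: "M > 0" using assms by (simp add: M_def add_pos_pos)
  have "z \<noteq> M \<or> M \<noteq> 1" using assms by auto
  then have "M \<noteq> 1" 
    using assms by (auto simp: M_def)
  have l1: "ln (z / M) \<le> z / M - 1"
    using assms M by (intro ln_le_minus_one) simp
  have "ln (1 / M) \<noteq> 1 / M - 1"
    using ln_eq_minus_one[of "1 / M"] M \<open>M \<noteq> 1\<close> by auto
  then have l2: "ln (1 / M) < 1 / M - 1"
    using ln_le_minus_one[of "1 / M"] M by simp
  have "t * ln (z / M) + (1 - t) * ln (1 / M) < t * (z / M - 1) + (1 - t) * (1 / M - 1)"
    using assms l1 l2 by (intro add_le_less_mono mult_left_mono mult_strict_left_mono) auto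
  also have "\<dots> = (t * z + (1 - t)) / M - 1"
    using M by (simp add: field_simps)
  also have "\<dots> = 0" using M by (simp add: M_def)
  finally have "t * ln z < ln M"
    using assms M by (simp add: ln_div algebra_simps)
  then have "exp (t * ln z) < exp (ln M)" by (rule exp_less_mono)
  also have "exp (ln M) = M" using M by simp
  finally show ?thesis using assms by (simp add: powr_def M_def)
qed

lemma ratio_powr_mult:
  fixes a b t :: real
  assumes "a > 0" "b \<ge> 0"
  shows "(b / a) powr (1 - t) * a = b powr (1 - t) * a powr t"
proof -
  have "a = a powr (1 - t) * a powr t"
    using assms by (simp add: powr_add[symmetric])
  then have "(b / a) powr (1 - t) * a = (b powr (1 - t) / a powr (1 - t)) * (a powr (1 - t) * a powr t)"
    using assms by (simp add: powr_divide)
  then show ?thesis using assms by simp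
qed

lemma kernel_gap_self [simp]: "a > 0 \<Longrightarrow> kernel_gap n a a = 0"
  by (simp add: kernel_gap_def powr_add[symmetric])

text \<open>For \<open>n = 1\<close> this is \<open>ln x < x - 1\<close> at \<open>x = b / a\<close>; for \<open>n \<ge> 2\<close> it is the strict weighted inequality of
  arithmetic and geometric means. Strictness is what gives uniqueness of the optimal densities.\<close>

lemma kernel_gap_pos:
  assumes "a > 0" "b \<ge> 0" "n \<ge> 1" "b \<noteq> a" "\<not> (n = 1 \<and> b = 0)"
  shows "kernel_gap n a b > 0"
proof (cases "n = 1")
  case True
  then have b: "b > 0" using assms by auto
  have "ln (b / a) \<noteq> b / a - 1" using ln_eq_minus_one[of "b / a"] assms b by auto
  then have "ln (b / a) < b / a - 1" using ln_le_minus_one[of "b / a"] assms b by simp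
  then have "a * ln (b / a) < a * (b / a - 1)" using assms by simp
  then show ?thesis using True b assms by (simp add: kernel_gap_def ln_div algebra_simps)
next
  case False
  then have n: "n \<ge> 2" using assms by simp
  have t: "0 < 1 - 1 / real n" "1 - 1 / real n < 1" using n by auto
  have lt: "b powr (1 - 1 / n) * a powr (1 / n) < (1 - 1 / n) * b + a / n"
  proof (cases "b = 0")
    case True then show ?thesis using assms n by simp
  next
    case False
    then have b: "b > 0" using assms by simp
    have "(b / a) powr (1 - 1 / n) < (1 - 1 / n) * (b / a) + (1 - (1 - 1 / n))"
      using assms b t by (intro weighted_am_gm_strict) auto
    then have "(b / a) powr (1 - 1 / n) * a < ((1 - 1 / n) * (b / a) + (1 - (1 - 1 / n))) * a"
      using assms by simp
    also have "\<dots> = (1 - 1 / n) * b + a / n"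
      using assms by (simp add: field_simps)
    also have "(b / a) powr (1 - 1 / n) * a = b powr (1 - 1 / n) * a powr (1 / n)"
      using assms by (simp add: ratio_powr_mult)
    finally show ?thesis .
  qed
  have "kernel_gap n a b = (real n)\<^sup>2 / (real n - 1) * ((1 - 1 / n) * b + a / n - b powr (1 - 1 / n) * a powr (1 / n))"
  proof -
    have "(real n)\<^sup>2 / (real n - 1) * (1 - 1 / n) = n"
      using n by (simp add: field_simps power2_eq_square)
    then have e: "n * (b - a) = (real n)\<^sup>2 / (real n - 1) * ((1 - 1 / n) * (b - a))"
      by (simp only: mult.assoc[symmetric])
    have "a - b powr (1 - 1 / n) * a powr (1 / n) + (1 - 1 / n) * (b - a)
        = (1 - 1 / n) * b + a / n - b powr (1 - 1 / n) * a powr (1 / n)"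
      by (simp add: algebra_simps diff_divide_distrib)
    then show ?thesis using False
      unfolding kernel_gap_def e by (simp only: if_False distrib_left[symmetric])
  qed
  then show ?thesis using lt n by simp
qed

lemma kernel_gap_nonneg:
  assumes "a > 0" "b \<ge> 0" "n \<ge> 1" "\<not> (n = 1 \<and> b = 0)"
  shows "kernel_gap n a b \<ge> 0"
  using kernel_gap_pos[OF assms(1,2,3) _ assms(4)] kernel_gap_self[OF assms(1), of n] by fastforce

lemma div_kernel_eq_0:
  assumes "div_kernel n a b = 0" "a > 0" "b \<ge> 0" "n \<ge> 1"
  shows "b = a"
  using kernel_gap_pos[of a b n] assms
  by (auto simp: div_kernel_def ennreal_eq_0_iff split: if_splits)

lemma measurable_kernel [measurable]:
  assumes [measurable]: "f \<in> borel_measurable M" "g \<in> borel_measurable M"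
  shows "(\<lambda>x. div_kernel n (f x) (g x)) \<in> borel_measurable M"
  unfolding div_kernel_def kernel_gap_def by measurable

lemma h_alpha_kernel:
  assumes "n \<ge> 1" "a > 0" "b \<ge> 0"
  shows "enn2ereal (div_kernel n a b) = h_alpha (1 - 2 / n) (b / a) * ereal a + ereal (n * b - n * a)"
proof (cases "n = 1")
  case True
  show ?thesis
  proof (cases "b = 0")
    case False
    then have "ln (a / b) = - ln (b / a)" using assms by (simp add: ln_div)
    then show ?thesis using kernel_gap_nonneg[of a b n] True False assms 
      by (simp add: div_kernel_def h_alpha_def kernel_gap_def enn2ereal_ennreal)
  qed (use True assms in \<open>simp add: div_kernel_def h_alpha_def\<close>)
next
  case False
  then have n: "n \<ge> 2" using assms by simp
  have al: "1 - 2 / real n \<noteq> -1" using n by (simp add: field_simps)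
  have c: "4 / (1 - (1 - 2 / real n)\<^sup>2) = (real n)\<^sup>2 / (real n - 1)"
    using n by (simp add: field_simps power2_eq_square)
  have e: "(1 + (1 - 2 / real n)) / 2 = 1 - 1 / n" by (simp add: field_simps)
  have p: "(1 - (b / a) powr (1 - 1 / n)) * a = a - b powr (1 - 1 / n) * a powr (1 / n)"
    using ratio_powr_mult[OF assms(2,3), of "1 / n"] by (simp add: left_diff_distrib)
  have "h_alpha (1 - 2 / n) (b / a) * ereal a
      = ereal ((real n)\<^sup>2 / (real n - 1) * ((1 - (b / a) powr (1 - 1 / n)) * a))"
    unfolding h_alpha_def c e using al by (simp add: mult.assoc)
  then show ?thesis
    using kernel_gap_nonneg[of a b n] assms False
    by (simp add: p div_kernel_def kernel_gap_def enn2ereal_ennreal right_diff_distrib)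
qed

text \<open>Adding \<open>u - v\<close> with equal finite integrals does not change an extended-real integral, even an infinite
  one. Nonnegativity of \<open>f + u - v\<close> bounds the negative part of \<open>f\<close> by \<open>u\<close>, which excludes \<open>\<infinity> - \<infinity>\<close>.\<close>

lemma ereal_integral_shift:
  fixes K :: "'a \<Rightarrow> ennreal" and u v :: "'a \<Rightarrow> real"
  assumes [measurable]: "f \<in> borel_measurable M" "K \<in> borel_measurable M"
      "u \<in> borel_measurable M" "v \<in> borel_measurable M"
    and u: "\<And>x. 0 \<le> u x" and v: "\<And>x. 0 \<le> v x"
    and uv: "(\<integral>\<^sup>+ x. ennreal (u x) \<partial>M) = (\<integral>\<^sup>+ x. ennreal (v x) \<partial>M)"
    and fin: "(\<integral>\<^sup>+ x. ennreal (v x) \<partial>M) < \<infinity>"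
    and K: "\<And>x. enn2ereal (K x) = f x + ereal (u x - v x)"
  shows "ereal_integral M f = enn2ereal (\<integral>\<^sup>+ x. K x \<partial>M)"
proof -
  have pw: "e2ennreal (f x) + ennreal (u x) = (K x + ennreal (v x)) + e2ennreal (- f x)
      \<and> e2ennreal (- f x) \<le> ennreal (u x)" for x
  proof (cases "f x")
    case (real r)
    have k: "0 \<le> r + (u x - v x)" using K[of x] real enn2ereal_nonneg[of "K x"] by simp
    then have "K x = ennreal (r + (u x - v x))"
      using K[of x] real by (metis e2ennreal_enn2ereal e2ennreal_ereal plus_ereal.simps(1))
    then have "K x + ennreal (v x) = ennreal (r + u x)"
      using k v[of x] by (simp flip: ennreal_plus)
    moreover have "ennreal r + ennreal (u x) = ennreal (r + u x) + ennreal (- r)"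
    proof (cases "r \<ge> 0")
      case True then show ?thesis using u[of x] by (simp add: ennreal_neg)
    next
      case False
      then have "ennreal (u x) = ennreal (r + u x) + ennreal (- r)"
        using k v[of x] by (simp flip: ennreal_plus)
      then show ?thesis using False by (simp add: ennreal_neg)
    qed
    moreover have "ennreal (- r) \<le> ennreal (u x)"
      using k u[of x] v[of x] by (intro ennreal_leI) simp
    ultimately show ?thesis using real by simp
  next
    case PInf
    then have "K x = \<infinity>" using K[of x] by (metis e2ennreal_enn2ereal e2ennreal_infty infinity_ennreal_def plus_ereal.simps(2))
    with PInf show ?thesis by (simp add: e2ennreal_neg)
  next
    case MInf
    then show ?thesis using K[of x] enn2ereal_nonneg[of "K x"] by simp
  qed
  let ?p = "\<integral>\<^sup>+ x. e2ennreal (f x) \<partial>M" and ?m = "\<integral>\<^sup>+ x. e2ennreal (- f x) \<partial>M"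
  let ?u = "\<integral>\<^sup>+ x. ennreal (u x) \<partial>M" and ?k = "\<integral>\<^sup>+ x. K x \<partial>M"
  have "?p + ?u = (\<integral>\<^sup>+ x. e2ennreal (f x) + ennreal (u x) \<partial>M)"
    by (rule nn_integral_add[symmetric]) measurable
  also have "\<dots> = (\<integral>\<^sup>+ x. (K x + ennreal (v x)) + e2ennreal (- f x) \<partial>M)"
    using pw by simp
  also have "\<dots> = (?k + ?u) + ?m"
    by (simp add: nn_integral_add uv)
  finally have "?u + ?p = ?u + (?k + ?m)" by (simp add: ac_simps)
  moreover have "?u \<noteq> \<infinity>" using fin uv by simp
  ultimately have pk: "?p = ?k + ?m" by (simp add: ennreal_add_left_cancel)
  have "?m \<le> ?u" using pw by (intro nn_integral_mono) simp
  then have "?m < \<infinity>" using fin uv by (simp add: le_less_trans)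
  then have "enn2ereal (?k + ?m) - enn2ereal ?m = enn2ereal ?k"
    by (cases ?m; cases ?k) (auto simp: plus_ennreal.rep_eq enn2ereal_ennreal)
  then show ?thesis unfolding ereal_integral_def pk .
qed

lemma ereal_integral_enn2ereal: "ereal_integral M (\<lambda>x. enn2ereal (F x)) = enn2ereal (\<integral>\<^sup>+ x. F x \<partial>M)"
  by (simp add: ereal_integral_def e2ennreal_neg zero_ennreal.rep_eq)

lemma alpha_loss_kernel:
  assumes "n \<ge> 1" "\<alpha> = 1 - 2 / real n" "\<sigma>Y > 0" "is_density q"
  shows "alpha_loss \<alpha> \<sigma>Y t q
    = enn2ereal (\<integral>\<^sup>+ y. div_kernel n (iso_normal (\<sigma>Y\<^sup>2) t y) (q (y::real^'p::finite)) \<partial>lborel)"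
proof -
  have v: "\<sigma>Y\<^sup>2 > 0" using assms by simp
  have [measurable]: "q \<in> borel_measurable borel" and q: "\<And>y. 0 \<le> q y" "(\<integral>\<^sup>+ y. ennreal (q y) \<partial>lborel) = 1"
    using assms by (auto simp: is_density_def)
  have n1: "(\<integral>\<^sup>+ y. ennreal (real n * g y) \<partial>lborel) = ennreal n"
    if [measurable]: "g \<in> borel_measurable borel" and "(\<integral>\<^sup>+ y. ennreal (g y) \<partial>lborel) = 1" "\<And>y. 0 \<le> g y"
    for g :: "real^'p \<Rightarrow> real"
    using that by (simp add: ennreal_mult nn_integral_cmult)
  show ?thesis
    unfolding alpha_loss_def Let_def mvn_density_scaled_mat_1[OF v]
  proof (rule ereal_integral_shift[where u = "\<lambda>y. n * q y" and v = "\<lambda>y. n * iso_normal (\<sigma>Y\<^sup>2) t y"])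
    show "(\<lambda>y. h_alpha \<alpha> (q y / iso_normal (\<sigma>Y\<^sup>2) t y) * ereal (iso_normal (\<sigma>Y\<^sup>2) t y)) \<in> borel_measurable lborel"
      unfolding h_alpha_def by measurable
    show "(\<integral>\<^sup>+ y. ennreal (n * q y) \<partial>lborel) = (\<integral>\<^sup>+ y. ennreal (n * iso_normal (\<sigma>Y\<^sup>2) t y) \<partial>lborel)"
      using q v by (simp add: n1 nn_integral_iso_normal)
    show "(\<integral>\<^sup>+ y. ennreal (n * iso_normal (\<sigma>Y\<^sup>2) t y) \<partial>lborel) < \<infinity>"
      using v by (simp add: n1 nn_integral_iso_normal)
  qed (use q v assms in \<open>auto simp: h_alpha_kernel iso_normal_pos\<close>)
qed

text \<open>The crucial structural fact: replacing \<open>q\<close> by \<open>b\<close> in the second argument changes the kernel by an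
  affine function of \<open>a powr (1 / n)\<close>. Averaging over \<open>a\<close> therefore only involves the mean of \<open>a powr (1 / n)\<close>.\<close>

lemma kernel_gap_transfer:
  assumes "a > 0" "q > 0" "b \<ge> 0" "n \<ge> 1" "\<not> (n = 1 \<and> b = 0)"
  shows "kernel_gap n a b - kernel_gap n a q
    = a powr (1 / n) * (if n = 1 then ln (q / b) else (real n)\<^sup>2 / (real n - 1) * (q powr (1 - 1 / n) - b powr (1 - 1 / n)))
      + n * (b - q)"
  using assms by (auto simp: kernel_gap_def ln_div algebra_simps diff_divide_distrib)

text \<open>Averaging \<open>kernel_gap_transfer\<close> over \<open>\<theta>\<close>, where the mean of \<open>a powr (1 / n)\<close> is \<open>s * q powr (1 / n)\<close>, gives \<open>s\<close>
  times the kernel at \<open>(q, b)\<close>, up to terms linear in \<open>b\<close> and \<open>q\<close>. These terms cancel once \<open>b\<close> and \<open>q\<close> are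
  integrated over two densities. They are distributed over both sides so that the identity can be stated
  with possibly infinite nonnegative terms.\<close>

lemma kernel_compensation:
  assumes "prob_space P" and [measurable]: "a \<in> borel_measurable P"
    and a: "\<And>\<theta>. a \<theta> > 0" and q: "q > 0" and b: "b \<ge> 0" and n: "n \<ge> 1" and s: "s > 0"
    and M: "(\<integral>\<^sup>+ \<theta>. ennreal (a \<theta> powr (1 / n)) \<partial>P) = ennreal (s * q powr (1 / n))"
  shows "(\<integral>\<^sup>+ \<theta>. div_kernel n (a \<theta>) b \<partial>P) + ennreal (n * s * b + n * q)
    = (\<integral>\<^sup>+ \<theta>. div_kernel n (a \<theta>) q \<partial>P) + ennreal s * div_kernel n q b + ennreal (n * b + n * s * q)"
proof (cases "n = 1 \<and> b = 0")
  case True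
  interpret prob_space P by fact
  show ?thesis using True s by (simp add: div_kernel_def emeasure_space_1 ennreal_mult_top)
next
  case False
  interpret prob_space P by fact
  define C where "C = (if n = 1 then ln (q / b) else (real n)\<^sup>2 / (real n - 1) * (q powr (1 - 1 / n) - b powr (1 - 1 / n)))"
  \<comment> \<open>The slope \<open>C\<close> is split into its positive and negative parts, because all terms must be nonnegative.\<close>
  define cp cm where "cp = max C 0" and "cm = max (- C) 0"
  have C: "C = cp - cm" "cp \<ge> 0" "cm \<ge> 0" by (auto simp: cp_def cm_def)
  define m where "m = s * q powr (1 / n)"
  have m: "m \<ge> 0" using s by (simp add: m_def)
  have dk: "div_kernel n x b = ennreal (kernel_gap n x b)" "div_kernel n x q = ennreal (kernel_gap n x q)" for x
    using False q by (auto simp: div_kernel_def)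
  have pos: "kernel_gap n x b \<ge> 0" "kernel_gap n x q \<ge> 0" if "x > 0" for x
    using that False q b n by (auto intro!: kernel_gap_nonneg)
  have pw: "div_kernel n (a \<theta>) b + ennreal (n * q) + ennreal cm * ennreal (a \<theta> powr (1 / n))
      = div_kernel n (a \<theta>) q + ennreal (n * b) + ennreal cp * ennreal (a \<theta> powr (1 / n))" for \<theta>
  proof -
    have "kernel_gap n (a \<theta>) b + n * q + cm * a \<theta> powr (1 / n) = kernel_gap n (a \<theta>) q + n * b + cp * a \<theta> powr (1 / n)"
      using kernel_gap_transfer[OF a q b n False, of \<theta>, folded C_def] by (simp add: C(1) algebra_simps)
    then show ?thesis
      using pos[OF a, of \<theta>] C(2,3) q b unfolding dk
      by (simp flip: ennreal_plus ennreal_mult)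
  qed
  let ?Eb = "\<integral>\<^sup>+ \<theta>. div_kernel n (a \<theta>) b \<partial>P" and ?Eq = "\<integral>\<^sup>+ \<theta>. div_kernel n (a \<theta>) q \<partial>P"
  have "(\<integral>\<^sup>+ \<theta>. div_kernel n (a \<theta>) b + ennreal (n * q) + ennreal cm * ennreal (a \<theta> powr (1 / n)) \<partial>P)
     = (\<integral>\<^sup>+ \<theta>. div_kernel n (a \<theta>) q + ennreal (n * b) + ennreal cp * ennreal (a \<theta> powr (1 / n)) \<partial>P)"
    unfolding pw ..
  then have "?Eb + ennreal (n * q) + ennreal cm * ennreal m = ?Eq + ennreal (n * b) + ennreal cp * ennreal m"
    by (simp add: nn_integral_add nn_integral_cmult M emeasure_space_1 m_def[symmetric])
  then have e1: "?Eb + ennreal (n * q + cm * m) = ?Eq + ennreal (n * b + cp * m)"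
    using q b C(2,3) m by (simp add: ennreal_plus ennreal_mult add.assoc)
  have "kernel_gap n q b = q powr (1 / n) * C + n * (b - q)"
    using kernel_gap_transfer[OF q q b n False, folded C_def] q by simp
  then have "s * kernel_gap n q b = m * (cp - cm) + n * s * b - n * s * q"
    by (simp only: C(1)) (simp add: m_def algebra_simps)
  then have r: "(n * b + cp * m) + n * s * b = cm * m + (s * kernel_gap n q b + (n * b + n * s * q))"
    by (simp add: algebra_simps)
  have "ennreal (cm * m) + (?Eb + ennreal (n * s * b + n * q)) = (?Eb + ennreal (n * q + cm * m)) + ennreal (n * s * b)"
    using q b C(2,3) m s by (simp add: ennreal_plus ac_simps)
  also have "\<dots> = ?Eq + ennreal ((n * b + cp * m) + n * s * b)"
    unfolding e1 using q b C(2,3) m s by (simp add: ennreal_plus add.assoc)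
  also have "\<dots> = ennreal (cm * m) + (?Eq + (ennreal (s * kernel_gap n q b) + ennreal (n * b + n * s * q)))"
    unfolding r using q b C(2,3) m s pos(1)[OF q] by (simp add: ennreal_plus ac_simps)
  finally show ?thesis
    using s pos(1)[OF q] by (simp add: ennreal_add_left_cancel dk ennreal_mult add.assoc)
qed


section \<open>Average divergence and its minimiser\<close>

definition mean_divergence :: "nat \<Rightarrow> 'b measure \<Rightarrow> ('b \<Rightarrow> real^'p \<Rightarrow> real) \<Rightarrow> (real^'p \<Rightarrow> real) \<Rightarrow> ennreal" where
  "mean_divergence n P f q = (\<integral>\<^sup>+ \<theta>. (\<integral>\<^sup>+ y. div_kernel n (f \<theta> y) (q y) \<partial>lborel) \<partial>P)"

text \<open>The Pythagorean identity behind both optimality claims: the excess of the average divergence of \<open>b\<close>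
  over that of \<open>q\<close> is \<open>s\<close> times the divergence of \<open>b\<close> from \<open>q\<close>. It is the integral over \<open>y\<close> of
  \<open>kernel_compensation\<close>, whose correction terms both integrate to \<open>n + n * s\<close>.\<close>

lemma mean_divergence_compensation:
  fixes f :: "'b \<Rightarrow> real^'p::finite \<Rightarrow> real"
  assumes P: "prob_space P" and [measurable]: "case_prod f \<in> borel_measurable (P \<Otimes>\<^sub>M borel)"
    and f: "\<And>\<theta> y. f \<theta> y > 0" and n: "n \<ge> 1" and s: "s > 0"
    and q: "is_density q" and q0: "\<And>y. q y > 0" and b: "is_density b"
    and M: "\<And>y. (\<integral>\<^sup>+ \<theta>. ennreal (f \<theta> y powr (1 / n)) \<partial>P) = ennreal (s * q y powr (1 / n))"
  shows "mean_divergence n P f b = mean_divergence n P f q + ennreal s * (\<integral>\<^sup>+ y. div_kernel n (q y) (b y) \<partial>lborel)"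
proof -
  interpret P: prob_space P by fact
  interpret pair_sigma_finite P "lborel :: (real^'p) measure" ..
  have [measurable]: "q \<in> borel_measurable borel" "b \<in> borel_measurable borel"
    and b0: "\<And>y. b y \<ge> 0" and q1: "(\<integral>\<^sup>+ y. ennreal (q y) \<partial>lborel) = 1" and b1: "(\<integral>\<^sup>+ y. ennreal (b y) \<partial>lborel) = 1"
    using q b by (auto simp: is_density_def)
  have swap: "mean_divergence n P f g = (\<integral>\<^sup>+ y. (\<integral>\<^sup>+ \<theta>. div_kernel n (f \<theta> y) (g y) \<partial>P) \<partial>lborel)"
    if [measurable]: "g \<in> borel_measurable borel" for g
    unfolding mean_divergence_def by (rule Fubini'[symmetric]) measurable
  have mix: "(\<integral>\<^sup>+ y. ennreal (c * g y + d * h y) \<partial>lborel) = ennreal (c + d)"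
    if [measurable]: "g \<in> borel_measurable borel" "h \<in> borel_measurable borel"
      and "\<And>y. g y \<ge> 0" "\<And>y. h y \<ge> 0" "c \<ge> 0" "d \<ge> 0"
      "(\<integral>\<^sup>+ y. ennreal (g y) \<partial>lborel) = 1" "(\<integral>\<^sup>+ y. ennreal (h y) \<partial>lborel) = 1"
    for c d :: real and g h :: "real^'p \<Rightarrow> real"
    using that by (simp add: ennreal_plus ennreal_mult nn_integral_add nn_integral_cmult)
  have "(\<integral>\<^sup>+ y. (\<integral>\<^sup>+ \<theta>. div_kernel n (f \<theta> y) (b y) \<partial>P) + ennreal (n * s * b y + n * q y) \<partial>lborel)
     = (\<integral>\<^sup>+ y. ((\<integral>\<^sup>+ \<theta>. div_kernel n (f \<theta> y) (q y) \<partial>P) + ennreal s * div_kernel n (q y) (b y))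
          + ennreal (n * b y + n * s * q y) \<partial>lborel)"
    by (subst kernel_compensation[OF P _ f q0 b0 n s M]) auto
  then have "mean_divergence n P f b + ennreal (n * s + n)
     = (mean_divergence n P f q + ennreal s * (\<integral>\<^sup>+ y. div_kernel n (q y) (b y) \<partial>lborel)) + ennreal (n + n * s)"
    using b0 q0 q1 b1 s
    by (simp add: nn_integral_add nn_integral_cmult swap mix less_imp_le del: ennreal_plus)
  then have "ennreal (n + n * s) + mean_divergence n P f b
     = ennreal (n + n * s) + (mean_divergence n P f q + ennreal s * (\<integral>\<^sup>+ y. div_kernel n (q y) (b y) \<partial>lborel))"
    by (simp add: ac_simps del: ennreal_plus)
  then show ?thesis by (simp add: ennreal_add_left_cancel)
qed

text \<open>Since \<open>t * exp (- t) \<le> 1\<close>, the quadratic factor is absorbed by doubling the variance.\<close>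

lemma iso_normal_second_moment:
  assumes "w > 0" "v > 0"
  shows "(\<integral>\<^sup>+ y. ennreal ((norm (y - x))\<^sup>2 / v * iso_normal w x (y::real^'p::finite)) \<partial>lborel) < \<infinity>"
proof -
  define c where "c = 4 * w / v * (sqrt ((2 * pi * (2 * w)) ^ CARD('p)) / sqrt ((2 * pi * w) ^ CARD('p)))"
  have c: "c \<ge> 0" using assms by (simp add: c_def)
  have le: "(norm (y - x))\<^sup>2 / v * iso_normal w x y \<le> c * iso_normal (2 * w) x y" for y
  proof -
    define t where "t = (norm (y - x))\<^sup>2 / (4 * w)"
    have "t \<le> exp t" using exp_ge_add_one_self[of t] by linarith
    then have "t * exp (- t) \<le> exp t * exp (- t)" by (intro mult_right_mono) auto
    then have "t * exp (- t) * exp (- t) \<le> 1 * exp (- t)"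
      by (intro mult_right_mono) (auto simp: exp_minus)
    moreover have "exp (- t) * exp (- t) = exp (- (norm (y - x))\<^sup>2 / (2 * w))"
      using assms by (simp add: t_def exp_add[symmetric] field_simps)
    moreover have "(norm (y - x))\<^sup>2 = 4 * w * t" using assms by (simp add: t_def)
    ultimately have "(norm (y - x))\<^sup>2 * exp (- (norm (y - x))\<^sup>2 / (2 * w)) \<le> 4 * w * exp (- t)"
      using assms by (simp add: mult.assoc)
    then have "(norm (y - x))\<^sup>2 * exp (- (norm (y - x))\<^sup>2 / (2 * w)) / (v * sqrt ((2 * pi * w) ^ CARD('p)))
      \<le> 4 * w * exp (- t) / (v * sqrt ((2 * pi * w) ^ CARD('p)))"
      using assms by (intro divide_right_mono) auto
    then show ?thesis using assms by (simp add: iso_normal_def c_def t_def)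
  qed
  have "(\<integral>\<^sup>+ y. ennreal ((norm (y - x))\<^sup>2 / v * iso_normal w x y) \<partial>lborel)
     \<le> (\<integral>\<^sup>+ y. ennreal c * ennreal (iso_normal (2 * w) x y) \<partial>lborel)"
    using le assms c by (intro nn_integral_mono) (simp flip: ennreal_mult add: ennreal_leI)
  also have "\<dots> = ennreal c"
    using assms by (simp add: nn_integral_cmult nn_integral_iso_normal)
  finally show ?thesis by (simp add: le_less_trans)
qed

text \<open>Uniqueness needs a finite minimum: otherwise all densities would tie at \<open>\<infinity>\<close>. For \<open>n \<ge> 2\<close> the kernel is bounded by a
  linear function. For \<open>n = 1\<close> the kernel is that of the Kullback-Leibler divergence, and the minimum is compared with
  the value at a fixed normal density with the same variance \<open>v\<close>, where the log-ratio is at most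
  quadratic in \<open>y\<close>. The bound on \<open>q\<close> by a multiple of a normal density controls the resulting second moment.\<close>

lemma mean_divergence_finite:
  fixes g :: "'b \<Rightarrow> real^'p::finite" and q :: "real^'p \<Rightarrow> real"
  assumes P: "prob_space P" and [measurable]: "g \<in> borel_measurable P"
    and v: "v > 0" and n: "n \<ge> 1" and s: "s > 0"
    and q: "is_density q" and q0: "\<And>y. q y > 0"
    and M: "\<And>y. (\<integral>\<^sup>+ \<theta>. ennreal (iso_normal v (g \<theta>) y powr (1 / n)) \<partial>P) = ennreal (s * q y powr (1 / n))"
    and dom: "w > 0" "C \<ge> 0" "\<And>y. q y \<le> C * iso_normal w x y"
  shows "mean_divergence n P (\<lambda>\<theta>. iso_normal v (g \<theta>)) q < \<infinity>"
proof -
  interpret P: prob_space P by fact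
  interpret pair_sigma_finite P "lborel :: (real^'p) measure" ..
  have [measurable]: "q \<in> borel_measurable borel" and q1: "(\<integral>\<^sup>+ y. ennreal (q y) \<partial>lborel) = 1"
    using q by (auto simp: is_density_def)
  show ?thesis
  proof (cases "n = 1")
    case False
    then have n2: "n \<ge> 2" using n by simp
    define K where "K = (real n)\<^sup>2 / (real n - 1)"
    have K: "K \<ge> 0" using n2 by (simp add: K_def)
    have dk: "div_kernel n a b \<le> ennreal K * ennreal a + ennreal n * ennreal b"
      if "a > 0" "b > 0" for a b
    proof -
      have "kernel_gap n a b = K * (a - b powr (1 - 1 / n) * a powr (1 / n)) + n * (b - a)"
        using False by (simp only: kernel_gap_def if_False K_def)
      moreover have "K * (a - b powr (1 - 1 / n) * a powr (1 / n)) \<le> K * a"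
        using K that by (intro mult_left_mono) auto
      moreover have "n * (b - a) \<le> n * b"
        using that by (intro mult_left_mono) auto
      ultimately have "kernel_gap n a b \<le> K * a + n * b" by linarith
      then have "div_kernel n a b \<le> ennreal (K * a + n * b)"
        using False by (simp add: div_kernel_def ennreal_leI del: ennreal_plus)
      also have "\<dots> = ennreal K * ennreal a + ennreal n * ennreal b"
        using K that by (simp add: ennreal_mult)
      finally show ?thesis .
    qed
    have "mean_divergence n P (\<lambda>\<theta>. iso_normal v (g \<theta>)) q
      \<le> (\<integral>\<^sup>+ \<theta>. (\<integral>\<^sup>+ y. ennreal K * ennreal (iso_normal v (g \<theta>) y) + ennreal n * ennreal (q y) \<partial>lborel) \<partial>P)"
      unfolding mean_divergence_def by (intro nn_integral_mono dk iso_normal_pos[OF v] q0)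
    also have "\<dots> = ennreal K + ennreal n"
      using v by (simp add: nn_integral_add nn_integral_cmult nn_integral_iso_normal q1 P.emeasure_space_1)
    finally show ?thesis by (simp add: le_less_trans)
  next
    case True
    let ?r = "iso_normal v x"
    have mean: "(\<integral>\<^sup>+ \<theta>. ennreal (iso_normal v (g \<theta>) y) \<partial>P) = ennreal (s * q y)" for y
      using M[of y] True v q0[of y] by simp
    have kl: "div_kernel 1 (iso_normal v t y) (?r y)
        \<le> ennreal ((norm (y - x))\<^sup>2 / (2 * v)) * ennreal (iso_normal v t y) + ennreal (?r y)" for t y
    proof -
      have "ln (iso_normal v t y / ?r y) = (norm (y - x))\<^sup>2 / (2 * v) - (norm (y - t))\<^sup>2 / (2 * v)"
      proof -
        have e: "ln (exp p / k / (exp r / k)) = p - r" if "k > 0" for p r k :: real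
          using that by (simp add: ln_div)
        show ?thesis
          unfolding iso_normal_def using v by (subst e) auto
      qed
      then have "ln (iso_normal v t y / ?r y) \<le> (norm (y - x))\<^sup>2 / (2 * v)"
        using v by simp
      then have "iso_normal v t y * ln (iso_normal v t y / ?r y) \<le> iso_normal v t y * ((norm (y - x))\<^sup>2 / (2 * v))"
        using v by (intro mult_left_mono) auto
      then have "kernel_gap 1 (iso_normal v t y) (?r y) \<le> (norm (y - x))\<^sup>2 / (2 * v) * iso_normal v t y + ?r y"
        using iso_normal_pos[OF v, of t y] by (simp add: kernel_gap_def mult.commute)
      then show ?thesis
        using iso_normal_pos[OF v, of x y] iso_normal_pos[OF v, of t y] v
        by (simp add: div_kernel_def ennreal_leI flip: ennreal_plus ennreal_mult)
    qed
    have "mean_divergence n P (\<lambda>\<theta>. iso_normal v (g \<theta>)) q \<le> mean_divergence n P (\<lambda>\<theta>. iso_normal v (g \<theta>)) ?r"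
    proof -
      have "mean_divergence n P (\<lambda>\<theta>. iso_normal v (g \<theta>)) ?r = mean_divergence n P (\<lambda>\<theta>. iso_normal v (g \<theta>)) q
          + ennreal s * (\<integral>\<^sup>+ y. div_kernel n (q y) (?r y) \<partial>lborel)"
        by (rule mean_divergence_compensation[OF P _ iso_normal_pos[OF v] n s q q0 is_density_iso_normal[OF v] M]) measurable
      then show ?thesis by simp
    qed
    also have "\<dots> \<le> (\<integral>\<^sup>+ \<theta>. (\<integral>\<^sup>+ y. ennreal ((norm (y - x))\<^sup>2 / (2 * v)) * ennreal (iso_normal v (g \<theta>) y) + ennreal (?r y) \<partial>lborel) \<partial>P)"
      unfolding mean_divergence_def True by (intro nn_integral_mono kl)
    also have "\<dots> = (\<integral>\<^sup>+ \<theta>. (\<integral>\<^sup>+ y. ennreal ((norm (y - x))\<^sup>2 / (2 * v)) * ennreal (iso_normal v (g \<theta>) y) \<partial>lborel) \<partial>P) + 1"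
      using v by (simp add: nn_integral_add nn_integral_iso_normal P.emeasure_space_1)
    also have "(\<integral>\<^sup>+ \<theta>. (\<integral>\<^sup>+ y. ennreal ((norm (y - x))\<^sup>2 / (2 * v)) * ennreal (iso_normal v (g \<theta>) y) \<partial>lborel) \<partial>P)
       = (\<integral>\<^sup>+ y. (\<integral>\<^sup>+ \<theta>. ennreal ((norm (y - x))\<^sup>2 / (2 * v)) * ennreal (iso_normal v (g \<theta>) y) \<partial>P) \<partial>lborel)"
      by (rule Fubini'[symmetric]) measurable
    also have "\<dots> = (\<integral>\<^sup>+ y. ennreal ((norm (y - x))\<^sup>2 / (2 * v)) * ennreal (s * q y) \<partial>lborel)"
      by (simp add: nn_integral_cmult mean)
    also have "\<dots> \<le> (\<integral>\<^sup>+ y. ennreal (s * C) * ennreal ((norm (y - x))\<^sup>2 / (2 * v) * iso_normal w x y) \<partial>lborel)"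
    proof (intro nn_integral_mono)
      fix y
      have "s * q y \<le> s * (C * iso_normal w x y)" using dom s by (intro mult_left_mono) auto
      then have "(norm (y - x))\<^sup>2 / (2 * v) * (s * q y) \<le> (norm (y - x))\<^sup>2 / (2 * v) * (s * (C * iso_normal w x y))"
        by (rule mult_left_mono) (use v in simp)
      then show "ennreal ((norm (y - x))\<^sup>2 / (2 * v)) * ennreal (s * q y)
          \<le> ennreal (s * C) * ennreal ((norm (y - x))\<^sup>2 / (2 * v) * iso_normal w x y)"
        using s v dom q0[of y] by (simp add: ennreal_leI mult_ac flip: ennreal_mult)
    qed
    also have "\<dots> < \<infinity>"
      using iso_normal_second_moment[OF dom(1), of "2 * v" x] v
      by (simp add: nn_integral_cmult ennreal_mult_less_top)
    finally show ?thesis by simp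
  qed
qed

text \<open>The abstract Bayes rule for \<open>\<alpha>\<close>-divergence. The premise on \<open>s\<close> says that \<open>q\<close> is proportional to the \<open>n\<close>-th power of
  the mean of \<open>n\<close>-th roots of the sampling densities. The risk of a competitor then exceeds that
  of \<open>q\<close> by \<open>s\<close> times a divergence from \<open>q\<close>, which vanishes only for densities that agree with \<open>q\<close> almost
  everywhere.\<close>

theorem power_mean_density_optimal:
  fixes g :: "'b \<Rightarrow> real^'p::finite" and q q' :: "real^'p \<Rightarrow> real"
  assumes n: "n \<ge> 1" and \<alpha>: "\<alpha> = 1 - 2 / real n" and \<sigma>Y: "\<sigma>Y > 0"
    and P: "prob_space P" and [measurable]: "g \<in> borel_measurable P" and s: "s > 0"
    and q: "is_density q" and q0: "\<And>y. q y > 0"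
    and M: "\<And>y. (\<integral>\<^sup>+ \<theta>. ennreal (iso_normal (\<sigma>Y\<^sup>2) (g \<theta>) y powr (1 / n)) \<partial>P) = ennreal (s * q y powr (1 / n))"
    and dom: "w > 0" "C \<ge> 0" "\<And>y. q y \<le> C * iso_normal w x y"
    and q': "is_density q'"
  shows "ereal_integral P (\<lambda>\<theta>. alpha_loss \<alpha> \<sigma>Y (g \<theta>) q) \<le> ereal_integral P (\<lambda>\<theta>. alpha_loss \<alpha> \<sigma>Y (g \<theta>) q')" (is ?le)
    and "ereal_integral P (\<lambda>\<theta>. alpha_loss \<alpha> \<sigma>Y (g \<theta>) q') \<le> ereal_integral P (\<lambda>\<theta>. alpha_loss \<alpha> \<sigma>Y (g \<theta>) q)
      \<Longrightarrow> AE y in lborel. q' y = q y" (is "?ge \<Longrightarrow> ?ae")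
proof -
  have v: "\<sigma>Y\<^sup>2 > 0" using \<sigma>Y by simp
  let ?D = "mean_divergence n P (\<lambda>\<theta>. iso_normal (\<sigma>Y\<^sup>2) (g \<theta>))"
  have R: "ereal_integral P (\<lambda>\<theta>. alpha_loss \<alpha> \<sigma>Y (g \<theta>) b) = enn2ereal (?D b)" if "is_density b" for b
    by (simp add: alpha_loss_kernel[OF n \<alpha> \<sigma>Y that] ereal_integral_enn2ereal mean_divergence_def)
  have D: "?D q' = ?D q + ennreal s * (\<integral>\<^sup>+ y. div_kernel n (q y) (q' y) \<partial>lborel)"
    by (rule mean_divergence_compensation[OF P _ iso_normal_pos[OF v] n s q q0 q' M]) measurable
  show ?le
    unfolding R[OF q] R[OF q'] less_eq_ennreal.rep_eq[symmetric] D by simp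
  have fin: "?D q < \<infinity>"
    by (rule mean_divergence_finite[OF P _ v n s q q0 M dom]) measurable
  assume ?ge
  then have "?D q' \<le> ?D q"
    unfolding R[OF q] R[OF q'] less_eq_ennreal.rep_eq[symmetric] .
  then have "?D q + ennreal s * (\<integral>\<^sup>+ y. div_kernel n (q y) (q' y) \<partial>lborel) \<le> ?D q + 0"
    unfolding D by simp
  then have "ennreal s * (\<integral>\<^sup>+ y. div_kernel n (q y) (q' y) \<partial>lborel) = 0"
    using fin by (subst (asm) ennreal_add_left_cancel_le) auto
  then have "(\<integral>\<^sup>+ y. div_kernel n (q y) (q' y) \<partial>lborel) = 0"
    using s by simp
  moreover have [measurable]: "q \<in> borel_measurable borel" "q' \<in> borel_measurable borel"
    using q q' by (auto simp: is_density_def)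
  ultimately have "AE y in lborel. div_kernel n (q y) (q' y) = 0"
    by (subst (asm) nn_integral_0_iff_AE) auto
  then show ?ae
    using div_kernel_eq_0[OF _ q0 _ n] q' by (auto simp: is_density_def elim: eventually_mono)
qed


section \<open>Exchangeable normal vectors with blocks\<close>

lemma sum_UNIV_prod: "(\<Sum>r\<in>UNIV. f r) = (\<Sum>i\<in>UNIV. \<Sum>k\<in>UNIV. f (i::'n::finite, k::'p::finite))"
  by (subst UNIV_Times_UNIV[symmetric]) (simp only: sum.cartesian_product split_def prod.collapse)

lemma prod_UNIV_prod: "(\<Prod>r\<in>UNIV. f r) = (\<Prod>i\<in>UNIV. \<Prod>k\<in>UNIV. f (i::'n::finite, k::'p::finite))"
  by (subst UNIV_Times_UNIV[symmetric]) (simp only: prod.cartesian_product split_def prod.collapse)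

lemma kron_mult:
  "kron A C ** kron B D = kron (A ** B) (C ** (D::real^'p::finite^'p) :: real^'p^'p)"
  for A B :: "real^'n::finite^'n"
  by (simp add: kron_def matrix_matrix_mult_def vec_eq_iff sum_UNIV_prod sum_product mult_ac)

lemma kron_mat_1: "kron (mat 1 :: real^'n::finite^'n) (mat 1 :: real^'p::finite^'p) = mat 1"
  by (auto simp: kron_def mat_def vec_eq_iff prod_eq_iff)

lemma kron_transpose: "transpose (kron A B) = kron (transpose A) (transpose B)"
  by (simp add: kron_def transpose_def vec_eq_iff)

lemma kron_scaleR: "kron (c *\<^sub>R A) B = c *\<^sub>R kron A B"
  by (simp add: kron_def vec_eq_iff)

text \<open>The matrix \<open>1 1' \<otimes> I\<close>. It sums the blocks of a vector and puts the sum into every block.\<close>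

definition block_const :: "real^('n \<times> 'p)^('n::finite \<times> 'p::finite)" where
  "block_const = kron (outer 1 1) (mat 1)"

lemma block_const_square:
  "(block_const :: real^('n::finite \<times> 'p::finite)^('n \<times> 'p)) ** block_const = real CARD('n) *\<^sub>R block_const"
proof -
  have "outer 1 1 ** outer 1 1 = real CARD('n) *\<^sub>R (outer 1 1 :: real^'n^'n)"
    by (simp add: outer_def matrix_matrix_mult_def vec_eq_iff)
  then show ?thesis by (simp add: block_const_def kron_mult kron_scaleR)
qed

lemma block_const_mult_vec:
  "(block_const :: real^('n \<times> 'p)^('n \<times> 'p)) *v z = (\<chi> r. (\<Sum>i\<in>UNIV. block i z) $ snd r)" for z :: "real^('n::finite \<times> 'p::finite)"
  by (simp add: block_const_def kron_def outer_def mat_def block_def matrix_vector_mult_def vec_eq_iff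
      sum_UNIV_prod if_distrib if_distribR cong: if_cong)

lemma inner_blocks: "y \<bullet> z = (\<Sum>i\<in>UNIV. block i y \<bullet> block i z)" for z :: "real^('n::finite \<times> 'p::finite)"
  by (simp add: inner_vec_def block_def sum_UNIV_prod)

lemma inner_block_const:
  "z \<bullet> (block_const *v z) = (norm (\<Sum>i\<in>UNIV. block i z))\<^sup>2" for z :: "real^('n::finite \<times> 'p::finite)"
proof -
  have "block i (block_const *v z) = (\<Sum>i\<in>UNIV. block i z)" for i
    by (simp add: block_const_mult_vec block_def[of i] vec_eq_iff)
  then show ?thesis
    by (simp add: inner_blocks[of z] inner_sum_left[symmetric] power2_norm_eq_inner)
qed

lemma exchangeable_quadratic_form:
  "z \<bullet> ((a *\<^sub>R mat 1 + b *\<^sub>R block_const) *v z)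
    = a * (\<Sum>i\<in>UNIV. (norm (block i z))\<^sup>2) + b * (norm (\<Sum>i\<in>UNIV. block i z))\<^sup>2"
  for z :: "real^('n::finite \<times> 'p::finite)"
proof -
  have "z \<bullet> ((a *\<^sub>R mat 1 + b *\<^sub>R block_const) *v z) = a * (z \<bullet> z) + b * (z \<bullet> (block_const *v z))"
    by (simp add: matrix_vector_mult_add_rdistrib scaleR_matrix_vector_assoc[symmetric] inner_add_right)
  also have "z \<bullet> z = (\<Sum>i\<in>UNIV. (norm (block i z))\<^sup>2)"
    by (subst inner_blocks) (simp add: power2_norm_eq_inner)
  finally show ?thesis by (simp only: inner_block_const)
qed

lemma matrix_add_rdistrib: "(A + B) ** C = A ** C + B ** C" for C :: "real^'m::finite^'m"
  by (simp add: matrix_matrix_mult_def vec_eq_iff sum.distrib distrib_right)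

lemma matrix_add_scaleR_mult:
  fixes E :: "real^'m::finite^'m"
  assumes "E ** E = k *\<^sub>R E"
  shows "(a *\<^sub>R mat 1 + b *\<^sub>R E) ** (c *\<^sub>R mat 1 + d *\<^sub>R E) = (a * c) *\<^sub>R mat 1 + (a * d + b * c + b * d * k) *\<^sub>R E"
  by (simp add: matrix_add_ldistrib matrix_add_rdistrib scalar_matrix_assoc[symmetric] matrix_scalar_ac assms
      scaleR_add_left algebra_simps)

text \<open>The span of the identity and \<open>block_const\<close> is closed under multiplication, so the inverse can be sought
  there; its second coefficient solves a linear equation.\<close>

lemma matrix_inv_exchangeable:
  fixes t b :: real
  assumes "t > 0" "b \<ge> 0"
  shows "matrix_inv (t *\<^sub>R mat 1 + b *\<^sub>R block_const :: real^('n::finite \<times> 'p::finite)^('n \<times> 'p))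
    = (1 / t) *\<^sub>R mat 1 + (- b / (t * (t + CARD('n) * b))) *\<^sub>R block_const"
proof -
  define D where "D = t + CARD('n) * b"
  define y where "y = - b / (t * D)"
  have "D > 0" using assms by (simp add: D_def add_pos_nonneg)
  then have yD: "y * D = - (b / t)" using assms by (simp add: y_def)
  have "t * y + b * (1 / t) + b * y * CARD('n) = y * D + b / t"
    by (simp add: D_def algebra_simps)
  then have 1: "t * y + b * (1 / t) + b * y * CARD('n) = 0" by (simp add: yD)
  then have 2: "1 / t * b + y * t + y * b * CARD('n) = 0" by (simp add: mult_ac add_ac)
  have "t * (1 / t) = 1" "1 / t * t = 1" using assms by auto
  note eqs = matrix_add_scaleR_mult[OF block_const_square] 1 2 this
  have "matrix_inv (t *\<^sub>R mat 1 + b *\<^sub>R block_const :: real^('n \<times> 'p)^('n \<times> 'p)) = (1 / t) *\<^sub>R mat 1 + y *\<^sub>R block_const"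
    by (rule matrix_inv_eqI) (simp_all only: eqs scaleR_one scaleR_zero_left add_0_right)
  then show ?thesis by (simp only: y_def D_def)
qed

lemma matrix_mult_outer: "Q ** outer u v = outer (Q *v u) v" for u v :: "real^'n::finite"
  by (simp add: outer_def matrix_matrix_mult_def matrix_vector_mult_def vec_eq_iff sum_distrib_right mult.assoc)

lemma outer_mult_transpose: "outer u v ** transpose Q = outer u (Q *v v)" for u v :: "real^'n::finite"
  by (simp add: outer_def matrix_matrix_mult_def matrix_vector_mult_def transpose_def vec_eq_iff sum_distrib_left mult_ac)

text \<open>An orthogonal matrix \<open>Q\<close> that maps a coordinate vector to the normalised all-ones vector diagonalises
  \<open>1 1'\<close>, so \<open>Q \<otimes> I\<close> diagonalises the matrix. Its eigenvalues are \<open>t + n b\<close>, with multiplicity \<open>p\<close>, and \<open>t\<close>.\<close>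

lemma det_exchangeable:
  fixes t b :: real
  shows "det (t *\<^sub>R mat 1 + b *\<^sub>R block_const :: real^('n::finite \<times> 'p::finite)^('n \<times> 'p))
    = t ^ ((CARD('n) - 1) * CARD('p)) * (t + CARD('n) * b) ^ CARD('p)"
proof -
  let ?n = "real CARD('n)"
  obtain k :: 'n where True by simp
  let ?e = "axis k 1 :: real^'n" and ?a = "(1 / sqrt ?n) *\<^sub>R (1 :: real^'n)"
  have "norm (1 :: real^'n) = sqrt ?n"
    by (simp add: norm_vec_def L2_set_def)
  then have "norm ?a = 1" by simp
  then obtain Q :: "real^'n^'n" where Q: "orthogonal_matrix Q" "Q *v ?e = ?a"
    by (rule orthogonal_matrix_exists_basis)
  define W where "W = kron Q (mat 1 :: real^'p^'p)"
  define D where "D = t *\<^sub>R mat 1 + (b * ?n) *\<^sub>R kron (outer ?e ?e) (mat 1 :: real^'p^'p)"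
  have QQ: "Q ** transpose Q = mat 1" "transpose Q ** Q = mat 1"
    using Q(1) by (auto simp: orthogonal_matrix_def)
  have WW: "W ** transpose W = mat 1" "transpose W ** W = mat 1"
    by (simp_all add: W_def kron_transpose kron_mult QQ kron_mat_1)
  have o: "Q ** outer ?e ?e ** transpose Q = (1 / ?n) *\<^sub>R outer 1 1"
    unfolding matrix_mult_outer outer_mult_transpose Q(2)
    by (simp add: outer_def vec_eq_iff)
  have "W ** D ** transpose W = t *\<^sub>R mat 1 + (b * ?n) *\<^sub>R kron (Q ** outer ?e ?e ** transpose Q) (mat 1 :: real^'p^'p)"
    by (simp add: D_def matrix_add_ldistrib matrix_add_rdistrib scalar_matrix_assoc[symmetric] matrix_scalar_ac WW)
       (simp add: W_def kron_transpose kron_mult)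
  also have "\<dots> = t *\<^sub>R mat 1 + b *\<^sub>R block_const"
    by (simp add: o kron_scaleR block_const_def)
  finally have S: "t *\<^sub>R mat 1 + b *\<^sub>R block_const = W ** D ** transpose W" by simp
  have "det W * det (transpose W) = 1"
    using WW(1) by (metis det_I det_mul)
  then have "det (W ** D ** transpose W) = det D"
    by (simp add: det_mul mult.assoc)
  also have "\<dots> = (\<Prod>r\<in>UNIV. D $ r $ r)"
    by (rule det_diagonal) (auto simp: D_def mat_def kron_def outer_def axis_def prod_eq_iff)
  also have "\<dots> = (\<Prod>i\<in>UNIV. \<Prod>j\<in>(UNIV::'p set). if i = k then t + ?n * b else t)"
    unfolding prod_UNIV_prod by (intro prod.cong) (auto simp: D_def mat_def kron_def outer_def axis_def)
  also have "\<dots> = (\<Prod>i\<in>UNIV. if i = k then (t + ?n * b) ^ CARD('p) else t ^ CARD('p))"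
    by (intro prod.cong) auto
  also have "\<dots> = (t + ?n * b) ^ CARD('p) * (\<Prod>i\<in>UNIV - {k}. t ^ CARD('p))"
    by (subst prod.remove[of _ k]) (auto intro!: prod.cong)
  also have "\<dots> = t ^ ((CARD('n) - 1) * CARD('p)) * (t + ?n * b) ^ CARD('p)"
    by (simp add: card_Diff_singleton power_mult[symmetric] mult.commute)
  finally show ?thesis by (simp add: S)
qed


lemma borel_measurable_vec_lambda:
  assumes "\<And>r. (\<lambda>x. f x r) \<in> borel_measurable M"
  shows "(\<lambda>x. \<chi> r. f x r :: real^'m::finite) \<in> borel_measurable M"
proof (rule borel_measurable_euclidean_space[THEN iffD2], rule ballI)
  fix b :: "real^'m" assume "b \<in> Basis"
  then obtain r where "b = axis r 1" by (auto simp: Basis_vec_def)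
  then show "(\<lambda>x. (\<chi> r. f x r) \<bullet> b) \<in> borel_measurable M"
    using assms by (simp add: inner_axis)
qed

lemma borel_measurable_vec_nth [measurable]: "(\<lambda>x::real^'m::finite. x $ r) \<in> borel_measurable borel"
  by (intro borel_measurable_continuous_onI continuous_intros)

lemma borel_measurable_block [measurable]: "block i \<in> borel_measurable borel"
proof -
  have "(\<lambda>z. block i z) \<in> borel_measurable borel"
    unfolding block_def by (rule borel_measurable_vec_lambda) measurable
  then show ?thesis .
qed

definition join_blocks :: "('n \<Rightarrow> real^'p) \<Rightarrow> real^('n::finite \<times> 'p::finite)" where
  "join_blocks f = (\<chi> r. f (fst r) $ snd r)"

lemma block_join_blocks [simp]: "block i (join_blocks f) = f i"
  by (simp add: block_def join_blocks_def vec_eq_iff)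

lemma measurable_join_blocks [measurable]:
  "join_blocks \<in> (\<Pi>\<^sub>M i\<in>UNIV. (lborel :: (real^'p::finite) measure)) \<rightarrow>\<^sub>M borel"
proof -
  have "(\<lambda>f. join_blocks f) \<in> (\<Pi>\<^sub>M i\<in>UNIV. (lborel :: (real^'p) measure)) \<rightarrow>\<^sub>M borel"
    unfolding join_blocks_def by (rule borel_measurable_vec_lambda) measurable
  then show ?thesis .
qed

text \<open>Lebesgue measure is determined by the volumes of boxes, and the preimage of a box under \<open>join_blocks\<close> is a
  product of boxes, one for each block.\<close>

lemma lborel_join_blocks:
  "distr (\<Pi>\<^sub>M i\<in>(UNIV::'n set). (lborel :: (real^'p) measure)) borel join_blocks
    = (lborel :: (real^('n::finite \<times> 'p::finite)) measure)"
proof (rule lborel_eqI[symmetric])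
  let ?P = "\<Pi>\<^sub>M i\<in>(UNIV::'n set). (lborel :: (real^'p) measure)"
  interpret product_sigma_finite "\<lambda>i::'n. lborel :: (real^'p) measure" ..
  have Basis_prod: "(\<Prod>b\<in>Basis. v \<bullet> b) = (\<Prod>r\<in>UNIV. v $ r)" for v :: "real^'m::finite"
  proof -
    have "(\<Prod>b\<in>Basis. v \<bullet> b) = (\<Prod>b\<in>range (\<lambda>r. axis r (1::real)). v \<bullet> b)"
      by (intro prod.cong) (auto simp: Basis_vec_def)
    also have "\<dots> = (\<Prod>r\<in>UNIV. v $ r)"
      by (subst prod.reindex) (auto simp: inj_on_def axis_eq_axis inner_axis)
    finally show ?thesis .
  qed
  fix l u :: "real^('n \<times> 'p)" assume lu: "\<And>b. b \<in> Basis \<Longrightarrow> l \<bullet> b \<le> u \<bullet> b"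
  then have le: "l $ r \<le> u $ r" for r
    by (metis axis_in_Basis_iff cart_eq_inner_axis insertI1 Basis_real_def)
  have ble: "block i l \<bullet> b \<le> block i u \<bullet> b" if "b \<in> Basis" for i and b :: "real^'p"
    using that le by (auto simp: Basis_vec_def inner_axis block_def)
  have "emeasure (distr ?P borel join_blocks) (box l u) = emeasure ?P (join_blocks -` box l u \<inter> space ?P)"
    by (rule emeasure_distr) auto
  also have "join_blocks -` box l u \<inter> space ?P = (\<Pi>\<^sub>E i\<in>UNIV. box (block i l) (block i u))"
    by (auto simp: space_PiM join_blocks_def mem_box_cart block_def PiE_iff)
  also have "emeasure ?P \<dots> = (\<Prod>i\<in>UNIV. emeasure lborel (box (block i l) (block i u)))"
    by (rule emeasure_PiM) auto
  also have "\<dots> = (\<Prod>i\<in>UNIV. ennreal (\<Prod>k\<in>UNIV. (u - l) $ (i, k)))"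
    using ble by (simp add: Basis_prod block_def)
  also have "\<dots> = ennreal (\<Prod>r\<in>UNIV. (u - l) $ r)"
    using le unfolding prod_UNIV_prod by (intro prod_ennreal prod_nonneg) auto
  finally show "emeasure (distr ?P borel join_blocks) (box l u) = (\<Prod>b\<in>Basis. (u - l) \<bullet> b)"
    by (simp only: Basis_prod)
qed simp

text \<open>This is how independence of the \<open>Z\<^sub>i\<close> given \<open>y\<^sub>1\<close> enters: the conditional probability that all of them
  lie in \<open>A\<close> factorises.\<close>

lemma nn_integral_prod_blocks:
  fixes g :: "'n::finite \<Rightarrow> real^'p::finite \<Rightarrow> ennreal"
  assumes [measurable]: "\<And>i. g i \<in> borel_measurable borel"
  shows "(\<integral>\<^sup>+ z. (\<Prod>i\<in>UNIV. g i (block i z)) \<partial>lborel) = (\<Prod>i\<in>UNIV. \<integral>\<^sup>+ x. g i x \<partial>lborel)"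
proof -
  interpret product_sigma_finite "\<lambda>i::'n. lborel :: (real^'p) measure" ..
  let ?P = "\<Pi>\<^sub>M i\<in>(UNIV::'n set). (lborel :: (real^'p) measure)"
  have "(\<integral>\<^sup>+ z. (\<Prod>i\<in>UNIV. g i (block i z)) \<partial>lborel) = (\<integral>\<^sup>+ z. (\<Prod>i\<in>UNIV. g i (block i z)) \<partial>distr ?P borel join_blocks)"
    by (simp add: lborel_join_blocks)
  also have "\<dots> = (\<integral>\<^sup>+ f. (\<Prod>i\<in>UNIV. g i (f i)) \<partial>?P)"
    by (subst nn_integral_distr) auto
  also have "\<dots> = (\<Prod>i\<in>UNIV. \<integral>\<^sup>+ x. g i x \<partial>lborel)"
    by (rule product_nn_integral_prod) auto
  finally show ?thesis .
qed

text \<open>The hierarchical description of \<open>Z\<close>: given \<open>y\<close> from \<open>N(m, w I)\<close>, the blocks are independent with law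
  \<open>N(\<beta> (y - m) + d, \<tau> I)\<close>. Completing the square in \<open>y\<close> splits the joint density into the marginal density of \<open>Z\<close> and
  the conditional density of \<open>y\<close>. Here \<open>D\<close> is the eigenvalue of the covariance of \<open>Z\<close> on
  vectors with equal blocks.\<close>

lemma mvn_density_exchangeable:
  fixes z :: "real^('n::finite \<times> 'p::finite)" and \<tau> w \<beta> :: real
  assumes "\<tau> > 0" "w > 0"
  defines "D \<equiv> \<tau> + CARD('n) * (\<beta>\<^sup>2 * w)"
  shows "iso_normal w m y * (\<Prod>i\<in>UNIV. iso_normal \<tau> (\<beta> *\<^sub>R (y - m) + d) (block i z))
    = mvn_density (kron_vec 1 d) (\<tau> *\<^sub>R mat 1 + (\<beta>\<^sup>2 * w) *\<^sub>R block_const) z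
      * iso_normal (w * \<tau> / D) (m + (\<beta> * w / D) *\<^sub>R (\<Sum>i\<in>UNIV. block i z - d)) y"
proof -
  let ?n = "real CARD('n)"
  define u where "u = y - m"
  define U where "U i = block i z - d" for i
  define S where "S = (\<Sum>i\<in>UNIV. U i)"
  define Q where "Q = (\<Sum>i\<in>UNIV. (norm (U i))\<^sup>2)"
  define V where "V = \<tau> *\<^sub>R mat 1 + (\<beta>\<^sup>2 * w) *\<^sub>R (block_const :: real^('n \<times> 'p)^('n \<times> 'p))"
  have D: "D > 0" using assms by (simp add: D_def add_pos_nonneg)
  have b: "\<beta>\<^sup>2 * w \<ge> 0" using assms by simp
  have U: "block i (z - kron_vec 1 d) = U i" for i
    by (simp add: U_def block_def kron_vec_def vec_eq_iff)
  have quad: "(z - kron_vec 1 d) \<bullet> (matrix_inv V *v (z - kron_vec 1 d)) = Q / \<tau> - \<beta>\<^sup>2 * w / (\<tau> * D) * (norm S)\<^sup>2"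
    unfolding V_def matrix_inv_exchangeable[OF assms(1) b] D_def[symmetric]
    unfolding exchangeable_quadratic_form U by (simp add: Q_def S_def)
  have sumsq: "(\<Sum>i\<in>UNIV. (norm (U i - \<beta> *\<^sub>R u))\<^sup>2) = Q - 2 * \<beta> * (u \<bullet> S) + ?n * \<beta>\<^sup>2 * (norm u)\<^sup>2"
  proof -
    have "(norm (U i - \<beta> *\<^sub>R u))\<^sup>2 = (norm (U i))\<^sup>2 - 2 * \<beta> * (u \<bullet> U i) + \<beta>\<^sup>2 * (norm u)\<^sup>2" for i
      by (simp add: power2_norm_eq_inner inner_diff_left inner_diff_right inner_commute)
         (simp add: power2_eq_square algebra_simps)
    then show ?thesis
      by (simp add: sum.distrib sum_subtractf sum_distrib_left[symmetric] inner_sum_right[symmetric] Q_def S_def)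
  qed
  have square: "(norm u)\<^sup>2 / w + (Q - 2 * \<beta> * (u \<bullet> S) + ?n * \<beta>\<^sup>2 * (norm u)\<^sup>2) / \<tau>
     = (Q / \<tau> - \<beta>\<^sup>2 * w / (\<tau> * D) * (norm S)\<^sup>2) + (norm (u - (\<beta> * w / D) *\<^sub>R S))\<^sup>2 / (w * \<tau> / D)"
  proof -
    have "(norm (u - (\<beta> * w / D) *\<^sub>R S))\<^sup>2 = (norm u)\<^sup>2 - 2 * (\<beta> * w / D) * (u \<bullet> S) + (\<beta> * w / D)\<^sup>2 * (norm S)\<^sup>2"
      by (simp add: power2_norm_eq_inner inner_diff_left inner_diff_right inner_commute)
         (simp add: power2_eq_square algebra_simps)
    then have "(norm (u - (\<beta> * w / D) *\<^sub>R S))\<^sup>2 / (w * \<tau> / D)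
       = (norm u)\<^sup>2 * (D / (w * \<tau>)) - 2 * \<beta> / \<tau> * (u \<bullet> S) + \<beta>\<^sup>2 * w / (\<tau> * D) * (norm S)\<^sup>2"
      using assms(1,2) D by (simp add: diff_divide_distrib add_divide_distrib) (simp add: field_simps power2_eq_square)
    moreover have "D / (w * \<tau>) = 1 / w + ?n * \<beta>\<^sup>2 / \<tau>"
      using assms(1,2) by (simp add: D_def field_simps)
    ultimately show ?thesis
      by (simp only:) (simp add: add_divide_distrib diff_divide_distrib algebra_simps)
  qed
  have const: "sqrt ((2 * pi * w) ^ CARD('p)) * (\<Prod>i\<in>(UNIV::'n set). sqrt ((2 * pi * \<tau>) ^ CARD('p)))
     = sqrt ((2 * pi) ^ CARD('n \<times> 'p) * det V) * sqrt ((2 * pi * (w * \<tau> / D)) ^ CARD('p))"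
  proof -
    have n: "CARD('n) * CARD('p) = (CARD('n) - 1) * CARD('p) + CARD('p)"
      by (metis Suc_diff_1 mult_Suc add.commute zero_less_card_finite)
    have "(2 * pi * w) ^ CARD('p) * ((2 * pi * \<tau>) ^ CARD('p)) ^ CARD('n)
       = (2 * pi) ^ (CARD('n) * CARD('p)) * \<tau> ^ (CARD('n) * CARD('p)) * (2 * pi * w) ^ CARD('p)"
      by (simp add: power_mult_distrib power_mult[symmetric] mult_ac)
    also have "\<dots> = (2 * pi) ^ (CARD('n) * CARD('p)) * \<tau> ^ ((CARD('n) - 1) * CARD('p)) * (2 * pi * w * \<tau>) ^ CARD('p)"
      unfolding n power_add by (simp add: power_mult_distrib mult_ac)
    also have "(2 * pi * w * \<tau>) = D * (2 * pi * (w * \<tau> / D))" using D by simp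
    also have "(2 * pi) ^ (CARD('n) * CARD('p)) * \<tau> ^ ((CARD('n) - 1) * CARD('p)) * (D * (2 * pi * (w * \<tau> / D))) ^ CARD('p)
      = ((2 * pi) ^ CARD('n \<times> 'p) * det V) * (2 * pi * (w * \<tau> / D)) ^ CARD('p)"
    proof -
      have "det V = \<tau> ^ ((CARD('n) - 1) * CARD('p)) * D ^ CARD('p)"
        unfolding V_def D_def by (rule det_exchangeable)
      moreover have "CARD('n \<times> 'p) = CARD('n) * CARD('p)" by simp
      ultimately show ?thesis
        by (simp only: power_mult_distrib[of D] mult.assoc)
    qed
    finally have "sqrt ((2 * pi * w) ^ CARD('p)) * sqrt (((2 * pi * \<tau>) ^ CARD('p)) ^ CARD('n))
      = sqrt ((2 * pi) ^ CARD('n \<times> 'p) * det V) * sqrt ((2 * pi * (w * \<tau> / D)) ^ CARD('p))"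
      by (simp only: real_sqrt_mult[symmetric])
    then show ?thesis by (simp only: prod_constant real_sqrt_power)
  qed
  have "iso_normal w m y * (\<Prod>i\<in>UNIV. iso_normal \<tau> (\<beta> *\<^sub>R (y - m) + d) (block i z))
    = exp (- ((norm u)\<^sup>2 / w + (\<Sum>i\<in>UNIV. (norm (U i - \<beta> *\<^sub>R u))\<^sup>2) / \<tau>) / 2)
      / (sqrt ((2 * pi * w) ^ CARD('p)) * (\<Prod>i\<in>(UNIV::'n set). sqrt ((2 * pi * \<tau>) ^ CARD('p))))"
  proof -
    have eq: "block i z - (\<beta> *\<^sub>R u + d) = U i - \<beta> *\<^sub>R u" for i by (simp add: U_def)
    have "exp (- ((norm u)\<^sup>2 / w + (\<Sum>i\<in>UNIV. (norm (U i - \<beta> *\<^sub>R u))\<^sup>2) / \<tau>) / 2)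
      = exp (- (norm u)\<^sup>2 / (2 * w)) * exp (\<Sum>i\<in>UNIV. - (norm (U i - \<beta> *\<^sub>R u))\<^sup>2 / (2 * \<tau>))"
      by (simp add: exp_add[symmetric] sum_negf sum_divide_distrib[symmetric] field_simps)
    then show ?thesis
      by (simp add: iso_normal_def prod_dividef exp_sum u_def[symmetric] eq)
  qed
  also have "\<dots> = exp (- ((Q / \<tau> - \<beta>\<^sup>2 * w / (\<tau> * D) * (norm S)\<^sup>2) + (norm (u - (\<beta> * w / D) *\<^sub>R S))\<^sup>2 / (w * \<tau> / D)) / 2)
     / (sqrt ((2 * pi) ^ CARD('n \<times> 'p) * det V) * sqrt ((2 * pi * (w * \<tau> / D)) ^ CARD('p)))"
    unfolding sumsq square const ..
  also have "\<dots> = exp (- (Q / \<tau> - \<beta>\<^sup>2 * w / (\<tau> * D) * (norm S)\<^sup>2) / 2) / sqrt ((2 * pi) ^ CARD('n \<times> 'p) * det V)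
     * (exp (- (norm (u - (\<beta> * w / D) *\<^sub>R S))\<^sup>2 / (2 * (w * \<tau> / D))) / sqrt ((2 * pi * (w * \<tau> / D)) ^ CARD('p)))"
  proof -
    have e: "exp (- (p + r / k) / 2) = exp (- p / 2) * exp (- r / (2 * k))" for p r k :: real
      by (simp add: exp_add[symmetric] field_simps)
    show ?thesis unfolding e by simp
  qed
  also have "\<dots> = mvn_density (kron_vec 1 d) V z * iso_normal (w * \<tau> / D) (m + (\<beta> * w / D) *\<^sub>R S) y"
    by (simp only: mvn_density_def quad iso_normal_def u_def diff_diff_eq)
  finally show ?thesis by (simp only: V_def S_def U_def)
qed

text \<open>Integrating out \<open>y\<close> last instead of first: the probability that all blocks lie in \<open>A\<close> is the mean over \<open>y\<close> of
  an \<open>n\<close>-th power.\<close>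

lemma mvn_exchangeable_blocks:
  fixes A :: "(real^'p::finite) set" and \<tau> w \<beta> :: real
  assumes \<tau>: "\<tau> > 0" and w: "w > 0" and [measurable]: "A \<in> sets borel"
  defines "V \<equiv> \<tau> *\<^sub>R mat 1 + (\<beta>\<^sup>2 * w) *\<^sub>R (block_const :: real^('n::finite \<times> 'p)^('n \<times> 'p))"
  shows "emeasure (mvn (kron_vec 1 d) V) (\<Inter>i. {z. block i z \<in> A})
    = (\<integral>\<^sup>+ y. ennreal (iso_normal w m y) * (\<integral>\<^sup>+ t. ennreal (iso_normal \<tau> (\<beta> *\<^sub>R (y - m) + d) t) * indicator A t \<partial>lborel) ^ CARD('n) \<partial>lborel)"
proof -
  let ?D = "\<tau> + CARD('n) * (\<beta>\<^sup>2 * w)"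
  have D: "w * \<tau> / ?D > 0" using assms by (simp add: add_pos_nonneg)
  define c where "c z = m + (\<beta> * w / ?D) *\<^sub>R (\<Sum>i\<in>(UNIV::'n set). block i z - d)" for z
  have [measurable]: "c \<in> borel_measurable borel" 
  proof -
    have "(\<lambda>z. c z) \<in> borel_measurable borel" unfolding c_def by measurable
    then show ?thesis .
  qed
  have split: "ennreal (iso_normal w m y) * (\<Prod>i\<in>UNIV. ennreal (iso_normal \<tau> (\<beta> *\<^sub>R (y - m) + d) (block i z)))
      = ennreal (mvn_density (kron_vec 1 d) V z) * ennreal (iso_normal (w * \<tau> / ?D) (c z) y)" for y and z :: "real^('n \<times> 'p)"
    using mvn_density_exchangeable[OF \<tau> w, of m y \<beta> d z] \<tau> w D
    by (simp add: prod_ennreal ennreal_mult'[symmetric] ennreal_mult''[symmetric] V_def c_def)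
  have dens: "ennreal (mvn_density (kron_vec 1 d) V z)
     = (\<integral>\<^sup>+ y. ennreal (iso_normal w m y) * (\<Prod>i\<in>UNIV. ennreal (iso_normal \<tau> (\<beta> *\<^sub>R (y - m) + d) (block i z))) \<partial>lborel)" for z :: "real^('n \<times> 'p)"
    unfolding split by (simp add: nn_integral_cmult nn_integral_iso_normal[OF D])
  have [measurable]: "(\<Inter>i. {z. block i z \<in> A}) \<in> sets (borel :: (real^('n \<times> 'p)) measure)"
    by measurable
  have ind: "indicator (\<Inter>i. {z. block i z \<in> A}) z = (\<Prod>i\<in>UNIV. indicator A (block i z) :: ennreal)" for z :: "real^('n \<times> 'p)"
    by (auto simp: indicator_def)
  have meas: "(\<lambda>z. ennreal (mvn_density (kron_vec 1 d) V z)) \<in> borel_measurable (lborel :: (real^('n \<times> 'p)) measure)"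
    unfolding dens by measurable
  have "emeasure (mvn (kron_vec 1 d) V) (\<Inter>i. {z. block i z \<in> A})
     = (\<integral>\<^sup>+ z. ennreal (mvn_density (kron_vec 1 d) V z) * indicator (\<Inter>i. {z. block i z \<in> A}) z \<partial>lborel)"
    unfolding mvn_def by (rule emeasure_density[OF meas]) simp
  also have "\<dots> = (\<integral>\<^sup>+ z. (\<integral>\<^sup>+ y. ennreal (iso_normal w m y) *
      (\<Prod>i\<in>UNIV. ennreal (iso_normal \<tau> (\<beta> *\<^sub>R (y - m) + d) (block i z)) * indicator A (block i z)) \<partial>lborel) \<partial>(lborel :: (real^('n \<times> 'p)) measure))"
    unfolding dens ind by (simp add: nn_integral_multc[symmetric] prod.distrib mult.assoc)
  also have "\<dots> = (\<integral>\<^sup>+ y. (\<integral>\<^sup>+ z. ennreal (iso_normal w m y) *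
      (\<Prod>i\<in>UNIV. ennreal (iso_normal \<tau> (\<beta> *\<^sub>R (y - m) + d) (block i z)) * indicator A (block i z)) \<partial>(lborel :: (real^('n \<times> 'p)) measure)) \<partial>lborel)"
    by (rule lborel_pair.Fubini') measurable
  also have "\<dots> = (\<integral>\<^sup>+ y. ennreal (iso_normal w m y) * (\<integral>\<^sup>+ t. ennreal (iso_normal \<tau> (\<beta> *\<^sub>R (y - m) + d) t) * indicator A t \<partial>lborel) ^ CARD('n) \<partial>lborel)"
    by (subst nn_integral_cmult, measurable)
       (subst nn_integral_prod_blocks[where g = "\<lambda>i t. ennreal (iso_normal \<tau> (\<beta> *\<^sub>R (y - m) + d) t) * indicator A t" for y], auto)
  finally show ?thesis .
qed


section \<open>The minimum risk equivariant density\<close>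

lemma mvn_scaled_mat_1: "v > 0 \<Longrightarrow> mvn m (v *\<^sub>R mat 1) = density lborel (\<lambda>z. ennreal (iso_normal v m (z::real^'p::finite)))"
  by (simp add: mvn_def mvn_density_scaled_mat_1)

lemma prob_space_mvn_scaled_mat_1: "v > 0 \<Longrightarrow> prob_space (mvn m (v *\<^sub>R mat 1 :: real^'p::finite^'p))"
  by (rule prob_spaceI) (simp add: mvn_scaled_mat_1 emeasure_density nn_integral_iso_normal)

lemma alpha_loss_equivariant:
  fixes q :: "real^'p::finite \<Rightarrow> real^'p \<Rightarrow> real"
  assumes "n \<ge> 1" "\<alpha> = 1 - 2 / real n" "\<sigma>Y > 0" "is_equivariant q"
  shows "alpha_loss \<alpha> \<sigma>Y \<theta> (\<lambda>y. q y x) = alpha_loss \<alpha> \<sigma>Y (\<theta> - x) (\<lambda>y. q y 0)"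
proof -
  have dens: "\<And>x. is_density (\<lambda>y. q y x)" and eq: "\<And>c y x. q (y + c) (x + c) = q y x"
    using assms(4) by (auto simp: is_equivariant_def)
  have [measurable]: "(\<lambda>y. q y x) \<in> borel_measurable borel" using dens[of x] by (simp add: is_density_def)
  have "(\<integral>\<^sup>+ y. div_kernel n (iso_normal (\<sigma>Y\<^sup>2) \<theta> y) (q y x) \<partial>lborel)
      = (\<integral>\<^sup>+ y. div_kernel n (iso_normal (\<sigma>Y\<^sup>2) \<theta> (y + x)) (q (y + x) x) \<partial>lborel)"
    using nn_integral_translate[of "\<lambda>y. div_kernel n (iso_normal (\<sigma>Y\<^sup>2) \<theta> y) (q y x)" x] by simp
  also have "\<dots> = (\<integral>\<^sup>+ y. div_kernel n (iso_normal (\<sigma>Y\<^sup>2) (\<theta> - x) y) (q y 0) \<partial>lborel)"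
    using eq[of _ x 0] iso_normal_translate[of "\<sigma>Y\<^sup>2" \<theta> _ x] by simp
  finally show ?thesis by (simp add: alpha_loss_kernel[OF assms(1-3) dens])
qed

text \<open>The risk of an equivariant density is constant in \<open>\<theta>\<close>, and equals an average loss in which \<open>\<theta> - X\<^sub>1\<close> plays
  the part of a random parameter with law \<open>N(0, \<sigma>\<^sub>1\<^sup>2 I)\<close>. Minimum risk equivariance thus becomes an instance
  of \<open>power_mean_density_optimal\<close>.\<close>

lemma risk1_equivariant:
  fixes q :: "real^'p::finite \<Rightarrow> real^'p \<Rightarrow> real"
  assumes n: "n \<ge> 1" "\<alpha> = 1 - 2 / real n" and \<sigma>: "\<sigma>1 > 0" "\<sigma>Y > 0" and q: "is_equivariant q"
  shows "risk1 \<alpha> \<sigma>1 \<sigma>Y q \<theta> = ereal_integral (mvn 0 (\<sigma>1\<^sup>2 *\<^sub>R mat 1)) (\<lambda>t. alpha_loss \<alpha> \<sigma>Y t (\<lambda>y. q y 0))"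
proof -
  have v: "\<sigma>1\<^sup>2 > 0" using \<sigma> by simp
  have dens: "is_density (\<lambda>y. q y 0)" using q by (auto simp: is_equivariant_def)
  then have [measurable]: "(\<lambda>y. q y 0) \<in> borel_measurable borel" by (simp add: is_density_def)
  define F where "F t = (\<integral>\<^sup>+ y. div_kernel n (iso_normal (\<sigma>Y\<^sup>2) t y) (q y 0) \<partial>lborel)" for t
  have F [measurable]: "F \<in> borel_measurable borel"
  proof -
    have "(\<lambda>t. F t) \<in> borel_measurable borel" unfolding F_def by measurable
    then show ?thesis .
  qed
  have L: "alpha_loss \<alpha> \<sigma>Y t (\<lambda>y. q y 0) = enn2ereal (F t)" for t
    by (simp add: alpha_loss_kernel[OF n \<sigma>(2) dens] F_def)
  have "(\<integral>\<^sup>+ x. F (\<theta> - x) \<partial>mvn \<theta> (\<sigma>1\<^sup>2 *\<^sub>R mat 1)) = (\<integral>\<^sup>+ x. ennreal (iso_normal (\<sigma>1\<^sup>2) \<theta> x) * F (\<theta> - x) \<partial>lborel)"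
    unfolding mvn_scaled_mat_1[OF v] by (rule nn_integral_density) measurable
  also have "\<dots> = (\<integral>\<^sup>+ t. ennreal (iso_normal (\<sigma>1\<^sup>2) \<theta> (\<theta> - t)) * F (\<theta> - (\<theta> - t)) \<partial>lborel)"
    by (rule nn_integral_reflect[symmetric]) measurable
  also have "\<dots> = (\<integral>\<^sup>+ t. ennreal (iso_normal (\<sigma>1\<^sup>2) 0 t) * F t \<partial>lborel)"
    by (simp add: iso_normal_def)
  also have "\<dots> = (\<integral>\<^sup>+ t. F t \<partial>mvn 0 (\<sigma>1\<^sup>2 *\<^sub>R mat 1))"
    unfolding mvn_scaled_mat_1[OF v] by (rule nn_integral_density[symmetric]) measurable
  finally show ?thesis
    by (simp add: risk1_def alpha_loss_equivariant[OF n \<sigma>(2) q, of \<theta>] L ereal_integral_enn2ereal)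
qed

text \<open>Roots multiply variances by \<open>n\<close>, convolution adds \<open>\<sigma>\<^sub>1\<^sup>2\<close>, and the \<open>n\<close>-th power divides the sum by \<open>n\<close>; this is where
  the variance \<open>\<sigma>\<^sub>1\<^sup>2/n + \<sigma>\<^sub>Y\<^sup>2\<close> comes from.\<close>

lemma normal_power_mean:
  fixes n :: nat
  assumes "\<sigma>1 > 0" "\<sigma>Y > 0" "n \<ge> 1"
  obtains s where "s > 0" "\<And>y::real^'p::finite.
    (\<integral>\<^sup>+ t. ennreal (iso_normal (\<sigma>Y\<^sup>2) t y powr (1 / n)) \<partial>mvn 0 (\<sigma>1\<^sup>2 *\<^sub>R mat 1))
      = ennreal (s * iso_normal (\<sigma>1\<^sup>2 / n + \<sigma>Y\<^sup>2) 0 y powr (1 / n))"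
proof -
  have pos: "\<sigma>1\<^sup>2 > 0" "\<sigma>Y\<^sup>2 > 0" "real n > 0" "n * \<sigma>Y\<^sup>2 > 0" "\<sigma>1\<^sup>2 / n + \<sigma>Y\<^sup>2 > 0"
    using assms by (auto simp: add_pos_pos)
  obtain c where c: "c > 0" "\<And>m z::real^'p. iso_normal (\<sigma>Y\<^sup>2) m z powr (1 / n) = c * iso_normal (n * \<sigma>Y\<^sup>2) m z"
    using iso_normal_root[OF pos(2,3), where 'p='p] by blast
  obtain c' where c': "c' > 0" "\<And>m z::real^'p. iso_normal (\<sigma>1\<^sup>2 / n + \<sigma>Y\<^sup>2) m z powr (1 / n) = c' * iso_normal (n * (\<sigma>1\<^sup>2 / n + \<sigma>Y\<^sup>2)) m z"
    using iso_normal_root[OF pos(5,3), where 'p='p] by blast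
  have var: "n * (\<sigma>1\<^sup>2 / n + \<sigma>Y\<^sup>2) = \<sigma>1\<^sup>2 + n * \<sigma>Y\<^sup>2" using assms by (simp add: field_simps)
  show thesis
  proof
    show "c / c' > 0" using c c' by simp
    fix y :: "real^'p"
    have "(\<integral>\<^sup>+ t. ennreal (iso_normal (\<sigma>Y\<^sup>2) t y powr (1 / n)) \<partial>mvn 0 (\<sigma>1\<^sup>2 *\<^sub>R mat 1))
       = (\<integral>\<^sup>+ t. ennreal (iso_normal (\<sigma>1\<^sup>2) 0 t) * ennreal (iso_normal (\<sigma>Y\<^sup>2) t y powr (1 / n)) \<partial>lborel)"
      unfolding mvn_scaled_mat_1[OF pos(1)] by (rule nn_integral_density) measurable
    also have "\<dots> = (\<integral>\<^sup>+ t. ennreal c * (ennreal (iso_normal (\<sigma>1\<^sup>2) 0 t) * ennreal (iso_normal (n * \<sigma>Y\<^sup>2) y t)) \<partial>lborel)"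
    proof (rule nn_integral_cong)
      fix t :: "real^'p"
      show "ennreal (iso_normal (\<sigma>1\<^sup>2) 0 t) * ennreal (iso_normal (\<sigma>Y\<^sup>2) t y powr (1 / n))
        = ennreal c * (ennreal (iso_normal (\<sigma>1\<^sup>2) 0 t) * ennreal (iso_normal (n * \<sigma>Y\<^sup>2) y t))"
        using c(1) pos unfolding c(2) iso_normal_commute[of _ t y] by (simp add: ennreal_mult mult_ac)
    qed
    also have "\<dots> = ennreal c * ennreal (iso_normal (\<sigma>1\<^sup>2 + n * \<sigma>Y\<^sup>2) 0 y)"
      by (simp add: nn_integral_cmult iso_normal_convolution[OF pos(1,4)])
    also have "\<dots> = ennreal (c / c' * iso_normal (\<sigma>1\<^sup>2 / n + \<sigma>Y\<^sup>2) 0 y powr (1 / n))"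
      unfolding c'(2) var using c(1) c'(1) by (simp add: ennreal_mult')
    finally show "(\<integral>\<^sup>+ t. ennreal (iso_normal (\<sigma>Y\<^sup>2) t y powr (1 / n)) \<partial>mvn 0 (\<sigma>1\<^sup>2 *\<^sub>R mat 1))
      = ennreal (c / c' * iso_normal (\<sigma>1\<^sup>2 / n + \<sigma>Y\<^sup>2) 0 y powr (1 / n))" .
  qed
qed

lemma is_equivariant_iso_normal: "v > 0 \<Longrightarrow> is_equivariant (\<lambda>y x. iso_normal v x (y::real^'p::finite))"
  using iso_normal_translate[of v "x + c" "y + c" c for x y c :: "real^'p"]
  by (simp add: is_equivariant_def is_density_iso_normal)

lemma normal_mre:
  fixes \<alpha> \<sigma>1 \<sigma>Y :: real
  assumes n: "n \<ge> 1" and \<alpha>: "\<alpha> = 1 - 2 / real n" and \<sigma>: "\<sigma>1 > 0" "\<sigma>Y > 0"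
  defines "r \<equiv> \<lambda>(y::real^'p::finite) x. iso_normal (\<sigma>1\<^sup>2 / n + \<sigma>Y\<^sup>2) x y"
  shows "is_mre \<alpha> \<sigma>1 \<sigma>Y r"
    and "is_mre \<alpha> \<sigma>1 \<sigma>Y q \<Longrightarrow> AE y in lborel. q y x = r y x"
proof -
  let ?P = "mvn 0 (\<sigma>1\<^sup>2 *\<^sub>R mat 1) :: (real^'p) measure"
  have v: "\<sigma>1\<^sup>2 > 0" "\<sigma>1\<^sup>2 / n + \<sigma>Y\<^sup>2 > 0" using n \<sigma> by (auto simp: add_pos_pos)
  have eqv: "is_equivariant r" unfolding r_def by (rule is_equivariant_iso_normal[OF v(2)])
  obtain s where s: "s > 0" "\<And>y::real^'p.
    (\<integral>\<^sup>+ t. ennreal (iso_normal (\<sigma>Y\<^sup>2) t y powr (1 / n)) \<partial>?P) = ennreal (s * r y 0 powr (1 / n))"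
    unfolding r_def using normal_power_mean[OF \<sigma> n] by blast
  have id: "(\<lambda>t. t) \<in> borel_measurable ?P" by (simp add: mvn_def)
  have dens: "is_density (\<lambda>y. r y 0)" using eqv by (simp add: is_equivariant_def)
  have pos: "r y 0 > 0" for y by (simp add: r_def iso_normal_pos v)
  have dom: "r y 0 \<le> 1 * iso_normal (\<sigma>1\<^sup>2 / n + \<sigma>Y\<^sup>2) 0 y" for y by (simp add: r_def)
  note opt = power_mean_density_optimal[OF n \<alpha> \<sigma>(2) prob_space_mvn_scaled_mat_1[OF v(1)] id s(1) dens pos s(2) v(2) zero_le_one dom]
  have R: "risk1 \<alpha> \<sigma>1 \<sigma>Y q \<theta> = ereal_integral ?P (\<lambda>t. alpha_loss \<alpha> \<sigma>Y t (\<lambda>y. q y 0))" if "is_equivariant q" for q \<theta>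
    by (rule risk1_equivariant[OF n \<alpha> \<sigma> that])
  show "is_mre \<alpha> \<sigma>1 \<sigma>Y r"
    unfolding is_mre_def using eqv opt(1) by (auto simp: R is_equivariant_def)
  assume q: "is_mre \<alpha> \<sigma>1 \<sigma>Y q"
  then have qe: "is_equivariant q" by (simp add: is_mre_def)
  then have qd: "is_density (\<lambda>y. q y 0)" by (simp add: is_equivariant_def)
  have "risk1 \<alpha> \<sigma>1 \<sigma>Y q 0 \<le> risk1 \<alpha> \<sigma>1 \<sigma>Y r 0" using q eqv by (simp add: is_mre_def)
  then have ae: "AE y in lborel. q y 0 = r y 0"
    unfolding R[OF qe] R[OF eqv] by (rule opt(2)[OF qd])
  have [measurable]: "(\<lambda>y. q y 0) \<in> borel_measurable borel" "(\<lambda>y. r y 0) \<in> borel_measurable borel"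
    using qd dens by (auto simp: is_density_def)
  have "AE y in distr lborel borel ((+) (- x)). q y 0 = r y 0"
    unfolding lborel_distr_plus by (rule ae)
  then have "AE y in lborel. q (- x + y) 0 = r (- x + y) 0"
    by (subst (asm) AE_distr_iff) auto
  moreover have shift: "f (- x + y) 0 = f y x" if "is_equivariant f" for f :: "real^'p \<Rightarrow> real^'p \<Rightarrow> real" and y
  proof -
    have "f (- x + y + x) (0 + x) = f (- x + y) 0" using that unfolding is_equivariant_def by blast
    then show ?thesis by simp
  qed
  ultimately show "AE y in lborel. q y x = r y x"
    by (simp only: shift[OF qe] shift[OF eqv])
qed


section \<open>The posterior for the uniform prior\<close>

lemma iso_normal_set_pos:
  assumes "v > 0" and [measurable]: "A \<in> sets borel" and A: "emeasure lborel A > 0"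
  shows "(\<integral>\<^sup>+ t. ennreal (iso_normal v m t) * indicator A (t::real^'p::finite) \<partial>lborel) > 0"
proof (rule ccontr)
  assume "\<not> ?thesis"
  then have "AE t in lborel. ennreal (iso_normal v m t) * indicator A t = 0"
    by (subst nn_integral_0_iff_AE[symmetric]) (auto simp: not_less)
  then have "AE t in lborel. t \<notin> A"
    by (rule AE_mp) (use iso_normal_pos[OF assms(1), of m] in \<open>auto simp: indicator_def ennreal_eq_0_iff not_le[symmetric]\<close>)
  then show False using A by (simp add: AE_iff_measurable[of A lborel "\<lambda>t. t \<notin> A"])
qed

lemma iso_normal_set_le_1:
  assumes "v > 0"
  shows "(\<integral>\<^sup>+ t. ennreal (iso_normal v m t) * indicator A (t::real^'p::finite) \<partial>lborel) \<le> 1"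
proof -
  have "(\<integral>\<^sup>+ t. ennreal (iso_normal v m t) * indicator A t \<partial>lborel) \<le> (\<integral>\<^sup>+ t. ennreal (iso_normal v m t) \<partial>lborel)"
    by (intro nn_integral_mono) (auto simp: indicator_def)
  then show ?thesis by (simp add: nn_integral_iso_normal assms)
qed

text \<open>The normalising constant of the posterior is the integral of the likelihood over \<open>\<theta>\<^sub>1 - \<theta>\<^sub>2 \<in> A\<close>. The
  likelihood is symmetric in observation and parameter, so this is the probability that a \<open>N(x\<^sub>1 - x\<^sub>2, (\<sigma>\<^sub>1\<^sup>2 + \<sigma>\<^sub>2\<^sup>2) I)\<close> vector lies in \<open>A\<close>.\<close>

lemma posterior_UA_integral:
  fixes A :: "(real^'p::finite) set"
  assumes \<sigma>: "\<sigma>1 > 0" "\<sigma>2 > 0" and A_borel [measurable]: "A \<in> sets borel"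
    and [measurable]: "f \<in> borel_measurable borel"
  shows "(\<integral>\<^sup>+ \<theta>. f (fst \<theta>) \<partial>posterior \<sigma>1 \<sigma>2 (prior_UA A) (x1, x2))
    = (\<integral>\<^sup>+ \<theta>1. (\<integral>\<^sup>+ \<theta>2. ennreal (iso_normal (\<sigma>1\<^sup>2) x1 \<theta>1) * ennreal (iso_normal (\<sigma>2\<^sup>2) x2 \<theta>2)
          * indicator A (\<theta>1 - \<theta>2) * f \<theta>1 \<partial>lborel) \<partial>lborel)
      / (\<integral>\<^sup>+ t. ennreal (iso_normal (\<sigma>1\<^sup>2 + \<sigma>2\<^sup>2) (x1 - x2) t) * indicator A t \<partial>lborel)"
    (is "_ = _ / ?N")
proof -
  have v: "\<sigma>1\<^sup>2 > 0" "\<sigma>2\<^sup>2 > 0" using \<sigma> by auto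
  define W where "W \<theta> = ennreal (iso_normal (\<sigma>1\<^sup>2) x1 (fst \<theta>)) * ennreal (iso_normal (\<sigma>2\<^sup>2) x2 (snd \<theta>)) * indicator A (fst \<theta> - snd \<theta>)"
    for \<theta> :: "(real^'p) \<times> (real^'p)"
  have W: "ennreal (likelihood \<sigma>1 \<sigma>2 (x1, x2) \<theta> * prior_UA A \<theta>) = W \<theta>" for \<theta>
    using v by (simp add: likelihood_def prior_UA_def W_def mvn_density_scaled_mat_1 ennreal_mult iso_normal_commute[of _ x1]
        iso_normal_commute[of _ x2] indicator_def)
  have [measurable]: "W \<in> borel_measurable borel"
  proof -
    have "(\<lambda>\<theta>. W \<theta>) \<in> borel_measurable (borel \<Otimes>\<^sub>M borel)" unfolding W_def by measurable
    then show ?thesis by (simp add: borel_prod)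
  qed
  have pair: "(\<integral>\<^sup>+ \<theta>. g \<theta> \<partial>lborel) = (\<integral>\<^sup>+ \<theta>1. (\<integral>\<^sup>+ \<theta>2. g (\<theta>1, \<theta>2) \<partial>lborel) \<partial>lborel)"
    if [measurable]: "g \<in> borel_measurable borel" for g :: "(real^'p) \<times> (real^'p) \<Rightarrow> ennreal"
    unfolding lborel_prod[symmetric] using that by (intro lborel.nn_integral_fst[symmetric]) (simp add: lborel_prod)
  have N: "(\<integral>\<^sup>+ \<theta>. W \<theta> \<partial>lborel) = ?N"
    by (subst pair) (simp_all add: W_def iso_normal_difference[OF v A_borel])
  have [measurable]: "(\<lambda>\<theta>. f (fst \<theta>)) \<in> borel_measurable (borel :: ((real^'p) \<times> (real^'p)) measure)"
    by (rule measurable_compose[OF borel_measurable_continuous_onI]) (auto intro: continuous_intros)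
  have "(\<integral>\<^sup>+ \<theta>. f (fst \<theta>) \<partial>posterior \<sigma>1 \<sigma>2 (prior_UA A) (x1, x2)) = (\<integral>\<^sup>+ \<theta>. W \<theta> / ?N * f (fst \<theta>) \<partial>lborel)"
    unfolding posterior_def W N by (rule nn_integral_density) auto
  also have "\<dots> = (\<integral>\<^sup>+ \<theta>. (W \<theta> * f (fst \<theta>)) / ?N \<partial>lborel)"
    by (simp add: divide_ennreal_def mult_ac)
  also have "\<dots> = (\<integral>\<^sup>+ \<theta>. W \<theta> * f (fst \<theta>) \<partial>lborel) / ?N"
    by (rule nn_integral_divide) measurable
  also have "(\<integral>\<^sup>+ \<theta>. W \<theta> * f (fst \<theta>) \<partial>lborel) = (\<integral>\<^sup>+ \<theta>1. (\<integral>\<^sup>+ \<theta>2. W (\<theta>1, \<theta>2) * f \<theta>1 \<partial>lborel) \<partial>lborel)"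
    by (subst pair) auto
  finally show ?thesis by (simp add: W_def)
qed


lemma prob_space_posterior_UA:
  fixes A :: "(real^'p::finite) set"
  assumes \<sigma>: "\<sigma>1 > 0" "\<sigma>2 > 0" and A_borel [measurable]: "A \<in> sets borel" and A: "emeasure lborel A > 0"
  shows "prob_space (posterior \<sigma>1 \<sigma>2 (prior_UA A) (x1, x2))"
proof (rule prob_spaceI)
  have v: "\<sigma>1\<^sup>2 > 0" "\<sigma>2\<^sup>2 > 0" "\<sigma>1\<^sup>2 + \<sigma>2\<^sup>2 > 0" using \<sigma> by (auto simp: add_pos_pos)
  let ?N = "\<integral>\<^sup>+ t. ennreal (iso_normal (\<sigma>1\<^sup>2 + \<sigma>2\<^sup>2) (x1 - x2) t) * indicator A t \<partial>lborel"
  have N: "?N > 0" "?N \<le> 1"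
    using iso_normal_set_pos[OF v(3) A_borel A] iso_normal_set_le_1[OF v(3)] by auto
  have "(\<integral>\<^sup>+ \<theta>. 1 \<partial>posterior \<sigma>1 \<sigma>2 (prior_UA A) (x1, x2)) = ?N / ?N"
    using posterior_UA_integral[OF \<sigma> A_borel, of "\<lambda>_. 1" x1 x2]
    by (simp add: iso_normal_difference[OF v(1,2) A_borel])
  also have "\<dots> = 1"
    using N(1) le_less_trans[OF N(2)] by (intro ennreal_divide_self) auto
  finally show "emeasure (posterior \<sigma>1 \<sigma>2 (prior_UA A) (x1, x2)) (space (posterior \<sigma>1 \<sigma>2 (prior_UA A) (x1, x2))) = 1"
    by simp
qed

text \<open>The root of the density of \<open>Y\<^sub>1\<close> acts like an additional observation \<open>y\<close> of \<open>\<theta>\<^sub>1\<close> with variance \<open>n \<sigma>\<^sub>Y\<^sup>2\<close>.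
  Combining it with \<open>x\<^sub>1\<close> leaves the convolution density at \<open>y\<close>, which is up to a
  constant the root of the \<open>N(x\<^sub>1, (\<sigma>\<^sub>1\<^sup>2/n + \<sigma>\<^sub>Y\<^sup>2) I)\<close> density, times a normal law for \<open>\<theta>\<^sub>1\<close> with mean \<open>x\<^sub>1 + \<beta> (y - x\<^sub>1)\<close> and variance
  \<open>n \<sigma>\<^sub>Y\<^sup>2 \<beta>\<close>. Under that law and \<open>\<theta>\<^sub>2\<close> independently \<open>N(x\<^sub>2, \<sigma>\<^sub>2\<^sup>2 I)\<close>, the difference \<open>\<theta>\<^sub>1 - \<theta>\<^sub>2\<close> has the law of \<open>T\<close>.\<close>

lemma posterior_UA_power_mean:
  fixes A :: "(real^'p::finite) set" and n :: nat and \<sigma>1 \<sigma>2 \<sigma>Y \<beta> :: real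
  assumes \<sigma>: "\<sigma>1 > 0" "\<sigma>2 > 0" "\<sigma>Y > 0" and n: "n \<ge> 1"
    and A_borel [measurable]: "A \<in> sets borel" and A: "emeasure lborel A > 0"
  defines "\<beta> \<equiv> \<sigma>1\<^sup>2 / (\<sigma>1\<^sup>2 + n * \<sigma>Y\<^sup>2)"
  obtains s where "s > 0" "\<And>y. (\<integral>\<^sup>+ \<theta>. ennreal (iso_normal (\<sigma>Y\<^sup>2) (fst \<theta>) y powr (1 / n)) \<partial>posterior \<sigma>1 \<sigma>2 (prior_UA A) (x1, x2))
      = ennreal (s * iso_normal (\<sigma>1\<^sup>2 / n + \<sigma>Y\<^sup>2) x1 y powr (1 / n))
        * (\<integral>\<^sup>+ t. ennreal (iso_normal (\<sigma>2\<^sup>2 + n * \<sigma>Y\<^sup>2 * \<beta>) (\<beta> *\<^sub>R (y - x1) + (x1 - x2)) t) * indicator A t \<partial>lborel)"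
proof -
  have v: "\<sigma>1\<^sup>2 > 0" "\<sigma>2\<^sup>2 > 0" "\<sigma>Y\<^sup>2 > 0" "real n > 0" "n * \<sigma>Y\<^sup>2 > 0" "\<sigma>1\<^sup>2 + n * \<sigma>Y\<^sup>2 > 0"
      "\<sigma>1\<^sup>2 + \<sigma>2\<^sup>2 > 0" "\<sigma>1\<^sup>2 / n + \<sigma>Y\<^sup>2 > 0"
    using \<sigma> n by (auto simp: add_pos_pos)
  then have \<beta>: "\<beta> > 0" by (simp add: \<beta>_def)
  define \<tau> where "\<tau> = n * \<sigma>Y\<^sup>2 * \<beta>"
  have \<tau>: "\<tau> > 0" using v \<beta> by (simp add: \<tau>_def)
  have \<tau>': "\<sigma>1\<^sup>2 * (n * \<sigma>Y\<^sup>2) / (\<sigma>1\<^sup>2 + n * \<sigma>Y\<^sup>2) = \<tau>" by (simp add: \<tau>_def \<beta>_def)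
  obtain c where c: "c > 0" "\<And>m z::real^'p. iso_normal (\<sigma>Y\<^sup>2) m z powr (1 / n) = c * iso_normal (n * \<sigma>Y\<^sup>2) m z"
    using iso_normal_root[OF v(3,4), where 'p='p] by blast
  obtain c' where c': "c' > 0" "\<And>m z::real^'p. iso_normal (\<sigma>1\<^sup>2 / n + \<sigma>Y\<^sup>2) m z powr (1 / n) = c' * iso_normal (n * (\<sigma>1\<^sup>2 / n + \<sigma>Y\<^sup>2)) m z"
    using iso_normal_root[OF v(8,4), where 'p='p] by blast
  have var: "n * (\<sigma>1\<^sup>2 / n + \<sigma>Y\<^sup>2) = \<sigma>1\<^sup>2 + n * \<sigma>Y\<^sup>2" using n by (simp add: field_simps)
  define N where "N = (\<integral>\<^sup>+ t. ennreal (iso_normal (\<sigma>1\<^sup>2 + \<sigma>2\<^sup>2) (x1 - x2) t) * indicator A t \<partial>lborel)"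
  have N: "N > 0" "N \<le> 1"
    using iso_normal_set_pos[OF v(7) A_borel A] iso_normal_set_le_1[OF v(7)] by (auto simp: N_def)
  then obtain N' where N': "N = ennreal N'" "N' > 0"
    by (cases N) (auto simp: top_unique)
  have "(\<integral>\<^sup>+ \<theta>. ennreal (iso_normal (\<sigma>Y\<^sup>2) (fst \<theta>) y powr (1 / n)) \<partial>posterior \<sigma>1 \<sigma>2 (prior_UA A) (x1, x2))
      = ennreal (c / (N' * c') * iso_normal (\<sigma>1\<^sup>2 / n + \<sigma>Y\<^sup>2) x1 y powr (1 / n))
        * (\<integral>\<^sup>+ t. ennreal (iso_normal (\<sigma>2\<^sup>2 + n * \<sigma>Y\<^sup>2 * \<beta>) (\<beta> *\<^sub>R (y - x1) + (x1 - x2)) t) * indicator A t \<partial>lborel)" for y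
  proof -
    let ?a = "x1 + \<beta> *\<^sub>R (y - x1)" and ?g = "iso_normal (\<sigma>1\<^sup>2 + n * \<sigma>Y\<^sup>2) x1 y"
    have pw: "ennreal (iso_normal (\<sigma>1\<^sup>2) x1 \<theta>1) * ennreal (iso_normal (\<sigma>2\<^sup>2) x2 \<theta>2) * indicator A (\<theta>1 - \<theta>2)
          * ennreal (iso_normal (\<sigma>Y\<^sup>2) \<theta>1 y powr (1 / n))
        = ennreal (c * ?g) * (ennreal (iso_normal \<tau> ?a \<theta>1) * ennreal (iso_normal (\<sigma>2\<^sup>2) x2 \<theta>2) * indicator A (\<theta>1 - \<theta>2))" for \<theta>1 \<theta>2
    proof -
      have "iso_normal (\<sigma>1\<^sup>2) x1 \<theta>1 * iso_normal (\<sigma>Y\<^sup>2) \<theta>1 y powr (1 / n) = c * ?g * iso_normal \<tau> ?a \<theta>1"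
        using iso_normal_mult[OF v(1,5), of x1 \<theta>1 y]
        unfolding c(2) iso_normal_commute[of _ \<theta>1 y] by (simp add: \<tau>' \<beta>_def[symmetric])
      then have "ennreal (iso_normal (\<sigma>1\<^sup>2) x1 \<theta>1) * ennreal (iso_normal (\<sigma>Y\<^sup>2) \<theta>1 y powr (1 / n))
          = ennreal (c * ?g) * ennreal (iso_normal \<tau> ?a \<theta>1)"
        using c(1) v \<tau> by (simp flip: ennreal_mult)
      then have "ennreal (iso_normal (\<sigma>1\<^sup>2) x1 \<theta>1) * ennreal (iso_normal (\<sigma>Y\<^sup>2) \<theta>1 y powr (1 / n)) * P
          = ennreal (c * ?g) * ennreal (iso_normal \<tau> ?a \<theta>1) * P" for P
        by simp
      from this[of "ennreal (iso_normal (\<sigma>2\<^sup>2) x2 \<theta>2) * indicator A (\<theta>1 - \<theta>2)"]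
      show ?thesis by (simp only: mult_ac)
    qed
    have "(\<integral>\<^sup>+ \<theta>. ennreal (iso_normal (\<sigma>Y\<^sup>2) (fst \<theta>) y powr (1 / n)) \<partial>posterior \<sigma>1 \<sigma>2 (prior_UA A) (x1, x2))
      = (\<integral>\<^sup>+ \<theta>1. (\<integral>\<^sup>+ \<theta>2. ennreal (iso_normal (\<sigma>1\<^sup>2) x1 \<theta>1) * ennreal (iso_normal (\<sigma>2\<^sup>2) x2 \<theta>2)
          * indicator A (\<theta>1 - \<theta>2) * ennreal (iso_normal (\<sigma>Y\<^sup>2) \<theta>1 y powr (1 / n)) \<partial>lborel) \<partial>lborel) / N"
      unfolding N_def by (rule posterior_UA_integral[OF \<sigma>(1,2) A_borel]) measurable
    also have "\<dots> = ennreal (c * ?g) * (\<integral>\<^sup>+ \<theta>1. (\<integral>\<^sup>+ \<theta>2. ennreal (iso_normal \<tau> ?a \<theta>1) * ennreal (iso_normal (\<sigma>2\<^sup>2) x2 \<theta>2)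
          * indicator A (\<theta>1 - \<theta>2) \<partial>lborel) \<partial>lborel) / N"
      unfolding pw by (simp add: nn_integral_cmult)
    also have "\<dots> = ennreal (c * ?g) / N * (\<integral>\<^sup>+ t. ennreal (iso_normal (\<sigma>2\<^sup>2 + \<tau>) (\<beta> *\<^sub>R (y - x1) + (x1 - x2)) t) * indicator A t \<partial>lborel)"
    proof -
      have args: "?a - x2 = \<beta> *\<^sub>R (y - x1) + (x1 - x2)" "\<tau> + \<sigma>2\<^sup>2 = \<sigma>2\<^sup>2 + \<tau>" by simp_all
      show ?thesis
        unfolding iso_normal_difference[OF \<tau> v(2) A_borel] args
        by (simp only: divide_ennreal_def mult_ac)
    qed
    also have "ennreal (c * ?g) / N = ennreal (c / (N' * c') * iso_normal (\<sigma>1\<^sup>2 / n + \<sigma>Y\<^sup>2) x1 y powr (1 / n))"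
      unfolding c'(2) var N'(1) using c(1) c'(1) N'(2) v by (simp add: divide_ennreal)
    finally show ?thesis unfolding \<tau>_def .
  qed
  then show thesis
    using that[of "c / (N' * c')"] c(1) c'(1) N'(2) by simp
qed

theorem lemma2p2:
  fixes \<alpha> \<sigma>1 \<sigma>2 \<sigma>Y :: real
    and A :: "(real^'p::finite) set"
    and x1 x2 :: "real^'p"
    and n :: nat
    and \<beta> \<sigma>T2 :: real
    and \<mu>T :: "real^'p \<Rightarrow> real^'p"
    and \<mu>Z :: "real^('n::finite \<times> 'p)"
    and SigmaZ :: "real^('n \<times> 'p)^('n \<times> 'p)"
    and q_mre :: "real^'p \<Rightarrow> real^'p \<Rightarrow> real"
    and q_bayes :: "real^'p \<Rightarrow> real"
  assumes "\<sigma>1 > 0" and "\<sigma>2 > 0" and "\<sigma>Y > 0"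
    and "real n = 2 / (1 - \<alpha>)" and "n = CARD('n)"
    and "A \<in> sets borel" and "emeasure lborel A > 0"
  defines "\<beta> \<equiv> \<sigma>1\<^sup>2 / (\<sigma>1\<^sup>2 + real n * \<sigma>Y\<^sup>2)"
    and "\<sigma>T2 \<equiv> \<sigma>2\<^sup>2 + real n * \<sigma>Y\<^sup>2 * \<beta>"
    and "\<mu>T \<equiv> \<lambda>y1. \<beta> *\<^sub>R (y1 - x1) + (x1 - x2)"
    and "\<mu>Z \<equiv> kron_vec (1 :: real^'n) (x1 - x2)"
    and "SigmaZ \<equiv> \<sigma>T2 *\<^sub>R mat 1
           + kron ((\<beta>\<^sup>2 * (\<sigma>1\<^sup>2 / real n + \<sigma>Y\<^sup>2)) *\<^sub>R outer (1 :: real^'n) 1) (mat 1 :: real^'p^'p)"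
    and "q_mre \<equiv> \<lambda>y1 x1. mvn_density x1 ((\<sigma>1\<^sup>2 / real n + \<sigma>Y\<^sup>2) *\<^sub>R mat 1) y1"
    and "q_bayes \<equiv> \<lambda>y1. q_mre y1 x1 * measure (mvn (\<mu>T y1) (\<sigma>T2 *\<^sub>R mat 1)) A ^ n
           / measure (mvn \<mu>Z SigmaZ) (\<Inter>i. {z. block i z \<in> A})"
  shows "is_mre \<alpha> \<sigma>1 \<sigma>Y q_mre
    \<and> (\<forall>q. is_mre \<alpha> \<sigma>1 \<sigma>Y q \<longrightarrow> (\<forall>x. AE y1 in lborel. q y1 x = q_mre y1 x))
    \<and> is_bayes_predictive \<alpha> \<sigma>1 \<sigma>2 \<sigma>Y (prior_UA A) (x1, x2) q_bayes
    \<and> (\<forall>q. is_bayes_predictive \<alpha> \<sigma>1 \<sigma>2 \<sigma>Y (prior_UA A) (x1, x2) q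
          \<longrightarrow> (AE y1 in lborel. q y1 = q_bayes y1))"
proof -
  have n: "n \<ge> 1" using assms(5) by (simp add: Suc_le_eq)
  then have "2 / real n = 1 - \<alpha>" unfolding assms(4) by auto
  then have \<alpha>: "\<alpha> = 1 - 2 / real n" by simp
  note \<sigma> = assms(1-3) and A_borel [measurable] = assms(6) and A = assms(7)
  let ?w = "\<sigma>1\<^sup>2 / real n + \<sigma>Y\<^sup>2"
  have w: "?w > 0" using \<sigma> n by (simp add: add_pos_pos)
  have \<beta>: "\<beta> > 0" using \<sigma> by (simp add: \<beta>_def add_pos_nonneg)
  have \<sigma>T2: "\<sigma>T2 > 0" using \<sigma> \<beta> by (simp add: \<sigma>T2_def add_pos_nonneg)
  have mre_eq: "q_mre = (\<lambda>y x. iso_normal ?w x y)"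
    by (simp add: q_mre_def mvn_density_scaled_mat_1[OF w])

  \<comment> \<open>The probability of \<open>T \<in> A\<close>, once as an extended and once as a real number.\<close>
  define E where "E y = (\<integral>\<^sup>+ t. ennreal (iso_normal \<sigma>T2 (\<mu>T y) t) * indicator A t \<partial>lborel)" for y
  define e where "e y = measure (mvn (\<mu>T y) (\<sigma>T2 *\<^sub>R mat 1)) A" for y
  have Ee: "E y = ennreal (e y)" and e: "0 < e y" "e y \<le> 1" for y
  proof -
    have "emeasure (mvn (\<mu>T y) (\<sigma>T2 *\<^sub>R mat 1)) A = E y"
      unfolding mvn_scaled_mat_1[OF \<sigma>T2] E_def by (rule emeasure_density) auto
    then have e_eq: "e y = enn2real (E y)" by (simp add: e_def measure_def)
    moreover have "0 < E y" "E y \<le> 1"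
      unfolding E_def by (rule iso_normal_set_pos[OF \<sigma>T2 A_borel A], rule iso_normal_set_le_1[OF \<sigma>T2])
    ultimately show "E y = ennreal (e y)" "0 < e y" "e y \<le> 1"
      by (cases "E y"; force simp: top_unique)+
  qed
  have [measurable]: "e \<in> borel_measurable borel"
  proof -
    have "(\<lambda>y. enn2real (E y)) \<in> borel_measurable borel" unfolding E_def \<mu>T_def by measurable
    moreover have "enn2real (E y) = e y" for y using Ee[of y] e(1)[of y] by simp
    ultimately show ?thesis by simp
  qed

  \<comment> \<open>The probability that all \<open>Z\<^sub>i\<close> lie in \<open>A\<close>. Its integral formula is the normalising constant of \<open>q_bayes\<close>,
    which makes \<open>q_bayes\<close> a density.\<close>
  define Zp where "Zp = emeasure (mvn \<mu>Z SigmaZ) (\<Inter>i. {z. block i z \<in> A})"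
  have Zp: "Zp = (\<integral>\<^sup>+ y. ennreal (iso_normal ?w x1 y * e y ^ n) \<partial>lborel)"
  proof -
    have SigmaZ: "SigmaZ = \<sigma>T2 *\<^sub>R mat 1 + (\<beta>\<^sup>2 * ?w) *\<^sub>R block_const"
      by (simp add: SigmaZ_def kron_scaleR block_const_def)
    have "Zp = (\<integral>\<^sup>+ y. ennreal (iso_normal ?w x1 y) * E y ^ n \<partial>lborel)"
      unfolding Zp_def SigmaZ \<mu>Z_def E_def \<mu>T_def assms(5)
      by (rule mvn_exchangeable_blocks[OF \<sigma>T2 w[unfolded assms(5)] A_borel])
    also have "\<dots> = (\<integral>\<^sup>+ y. ennreal (iso_normal ?w x1 y * e y ^ n) \<partial>lborel)"
      using e w by (simp add: Ee ennreal_power ennreal_mult less_imp_le)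
    finally show ?thesis .
  qed
  have "Zp \<le> (\<integral>\<^sup>+ y. ennreal (iso_normal ?w x1 y) \<partial>lborel)"
    unfolding Zp using e w
    by (intro nn_integral_mono ennreal_leI mult_right_le_one_le) (auto simp: power_le_one less_imp_le)
  then have Zp_le: "Zp \<le> 1" by (simp add: nn_integral_iso_normal[OF w])
  have "Zp \<noteq> 0"
  proof
    assume "Zp = 0"
    then have "AE y in lborel. ennreal (iso_normal ?w x1 y * e y ^ n) = 0"
      unfolding Zp by (subst (asm) nn_integral_0_iff_AE) auto
    then have "AE y in lborel. ennreal (iso_normal ?w x1 y) = 0"
    proof (rule AE_mp, intro AE_I2 impI)
      fix y
      have "iso_normal ?w x1 y * e y ^ n > 0" using e(1) w by (simp add: iso_normal_pos)
      moreover assume "ennreal (iso_normal ?w x1 y * e y ^ n) = 0"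
      ultimately show "ennreal (iso_normal ?w x1 y) = 0" by (simp add: ennreal_eq_0_iff)
    qed
    then have "(\<integral>\<^sup>+ y. ennreal (iso_normal ?w x1 y) \<partial>lborel) = 0"
      by (subst nn_integral_0_iff_AE) auto
    then show False by (simp add: nn_integral_iso_normal[OF w])
  qed
  define z where "z = measure (mvn \<mu>Z SigmaZ) (\<Inter>i. {z. block i z \<in> A})"
  have z: "Zp = ennreal z" "z > 0"
  proof -
    have "z = enn2real Zp" by (simp add: z_def Zp_def measure_def)
    then show "Zp = ennreal z" "z > 0"
      using Zp_le \<open>Zp \<noteq> 0\<close> by (cases Zp; force simp: top_unique)+
  qed
  have bayes_eq: "q_bayes y = iso_normal ?w x1 y * e y ^ n / z" for y
    by (simp add: q_bayes_def mre_eq e_def z_def)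
  have pos: "q_bayes y > 0" for y
    using e(1) z(2) w by (simp add: bayes_eq iso_normal_pos)
  have dens: "is_density q_bayes"
  proof -
    have "(\<lambda>y. q_bayes y) \<in> borel_measurable borel"
      unfolding bayes_eq by measurable
    moreover have "(\<integral>\<^sup>+ y. ennreal (q_bayes y) \<partial>lborel) = (\<integral>\<^sup>+ y. ennreal (iso_normal ?w x1 y * e y ^ n) / ennreal z \<partial>lborel)"
      using e z(2) w by (simp add: bayes_eq divide_ennreal less_imp_le)
    moreover have "\<dots> = Zp / ennreal z"
      unfolding Zp by (rule nn_integral_divide) measurable
    moreover have "Zp / ennreal z = 1"
      using z by (simp add: divide_ennreal)
    ultimately show ?thesis
      using pos by (simp add: is_density_def less_imp_le)
  qed
  obtain s where s: "s > 0" and mean: "\<And>y. (\<integral>\<^sup>+ \<theta>. ennreal (iso_normal (\<sigma>Y\<^sup>2) (fst \<theta>) y powr (1 / n)) \<partial>posterior \<sigma>1 \<sigma>2 (prior_UA A) (x1, x2))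
      = ennreal (s * iso_normal ?w x1 y powr (1 / n)) * E y"
    unfolding E_def \<sigma>T2_def \<mu>T_def \<beta>_def
    using posterior_UA_power_mean[OF \<sigma> n A_borel A, of x1 x2] by blast
  have mean': "(\<integral>\<^sup>+ \<theta>. ennreal (iso_normal (\<sigma>Y\<^sup>2) (fst \<theta>) y powr (1 / n)) \<partial>posterior \<sigma>1 \<sigma>2 (prior_UA A) (x1, x2))
      = ennreal (s * z powr (1 / n) * q_bayes y powr (1 / n))" for y
  proof -
    have "(e y ^ n) powr (1 / n) = e y"
      using e(1)[of y] n by (simp add: powr_powr powr_realpow[symmetric])
    then have "z powr (1 / n) * q_bayes y powr (1 / n) = iso_normal ?w x1 y powr (1 / n) * e y"
      using e(1)[of y] z(2) w by (simp add: bayes_eq powr_divide powr_mult)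
    then show ?thesis
      using e(1)[of y] s by (simp add: mean Ee mult.assoc flip: ennreal_mult)
  qed
  \<comment> \<open>As \<open>P(T \<in> A) \<le> 1\<close>, the density is dominated by a multiple of a normal density.\<close>
  have dom: "q_bayes y \<le> 1 / z * iso_normal ?w x1 y" for y
    using e z(2) w power_le_one[of "e y" n]
    by (simp add: bayes_eq divide_right_mono mult_right_le_one_le less_imp_le)
  have fst: "fst \<in> borel_measurable (posterior \<sigma>1 \<sigma>2 (prior_UA A) (x1, x2))"
    by (simp add: posterior_def borel_prod[symmetric])
  note opt = power_mean_density_optimal[OF n \<alpha> \<sigma>(3) prob_space_posterior_UA[OF \<sigma>(1,2) A_borel A] fst
      _ dens pos mean' w _ dom]
  have s': "s * z powr (1 / n) > 0" "1 / z \<ge> 0" using s z by auto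
  have "is_bayes_predictive \<alpha> \<sigma>1 \<sigma>2 \<sigma>Y (prior_UA A) (x1, x2) q_bayes"
    using dens opt(1)[OF s'] by (simp add: is_bayes_predictive_def posterior_expected_loss_def)
  moreover have "AE y in lborel. q y = q_bayes y" if "is_bayes_predictive \<alpha> \<sigma>1 \<sigma>2 \<sigma>Y (prior_UA A) (x1, x2) q" for q
    using that dens opt(2)[OF s', of q] by (simp add: is_bayes_predictive_def posterior_expected_loss_def)
  ultimately show ?thesis
    using normal_mre[OF n \<alpha> \<sigma>(1,3), where 'p='p] unfolding mre_eq by blast
qed

end
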